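(* Let $(R,\mathfrak m,k)$ be a local Artinian ring with embedding dimension $e$, top socle degree $s$, and socle polynomial $\sum_{i=0}^sc_iz^i$. Then the following statements hold. (a) The length of $R$ satisfies $$\lambda_R(R)\le\sum_{i=0}^s\min\Big\{\binom{(e-1)+i}{i},\ \sum_{\ell=i}^sc_\ell\binom{(e-1)+(\ell-i)}{\ell-i}\Big\}.$$ (b) Equality holds in the inequality of (a) if and only if $R$ is a compressed local Artinian ring. (c) If $R$ is a compressed local Artinian ring, then $s\le 2\,\mathtt v(R)-1$.
   Context: "$(R,\mathfrak m,k)$ is a local ring" means $R$ is a commutative Noetherian local ring with maximal ideal $\mathfrak m$ and residue field $k=R/\mathfrak m$. The embedding dimension of $R$ is $e=\dim_k(\mathfrak m/\mathfrak m^2)$; $\operatorname{socle}(R)=0:_R\mathfrak m$; $\lambda_R$ denotes length of $R$-modules. Set $$\mathtt v(R)=\inf\Big\{i\ \Big|\ \dim_k(\mathfrak m^i/\mathfrak m^{i+1})<\binom{(e-1)+i}{i}\Big\}.$$ If $R$ is a local Artinian ring, its top socle degree is the maximum integer $s$ with $\mathfrak m^s\ne 0$, and its socle polynomial is $\sum_{i=0}^s c_iz^i$ with $c_i=\dim_k\frac{\operatorname{socle}(R)\cap\mathfrak m^i}{\operatorname{socle}(R)\cap\mathfrak m^{i+1}}$. The local Artinian ring $R$ is called compressed if $$\dim_k(\mathfrak m^i/\mathfrak m^{i+1})=\min\Big\{\binom{(e-1)+i}{i},\ \sum_{\ell=i}^s c_\ell\binom{(e-1)+(\ell-i)}{\ell-i}\Big\}\quad\text{for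 }0\le i\le s.$$ *)

theory Defs
  imports
    "Jordan_Normal_Form.Missing_VectorSpace"
    "HOL-Algebra.Ideal_Product"
    "HOL-Algebra.Ring_Divisibility"
    "HOL-Library.Extended_Nat"
    "HOL-Computational_Algebra.Polynomial"
begin

hide_const (open) UnivPoly.coeff UnivPoly.monom

locale local_ring = cring R + noetherian_ring R
  for R (structure) and \<mm> +
  assumes maximal: "maximalideal \<mm> R"
    and unique_maximal: "maximalideal I R \<Longrightarrow> I = \<mm>"

locale local_artinian_ring = local_ring +
  assumes descending_chain:
    "\<lbrakk>\<And>n::nat. ideal (I n) R; \<And>n. I (Suc n) \<subseteq> I n\<rbrakk> \<Longrightarrow> \<exists>N. \<forall>n\<ge>N. I n = I N"

text \<open>In \<^const>\<open>ideals_set\<close> the unit is the whole ring, so the zeroth power is \<open>carrier R\<close>.\<close>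

abbreviation ideal_power :: "('a, 'b) ring_scheme \<Rightarrow> 'a set \<Rightarrow> nat \<Rightarrow> 'a set" where
  "ideal_power R I n \<equiv> I [^]\<^bsub>ideals_set R\<^esub> n"

text \<open>
  The quotient \<open>I/J\<close> of ideals \<open>J \<subseteq> I\<close> with \<open>\<mm> I \<subseteq> J\<close>, as a module over \<open>R Quot \<mm>\<close>.
  Under this condition the union of the cosets \<open>J + a x\<close> over \<open>a\<close> in a coset of \<open>\<mm>\<close> and
  \<open>x\<close> in a coset of \<open>J\<close> contained in \<open>I\<close> is a single coset of \<open>J\<close>, so \<^const>\<open>rcoset_mult\<close>
  is the scalar multiplication. The fields \<open>mult\<close> and \<open>one\<close>, which are inherited from the
  record of rings, play no role in a module.
\<close>

definition quotient_module ::
    "('a, 'b) ring_scheme \<Rightarrow> 'a set \<Rightarrow> 'a set \<Rightarrow> ('a set, 'a set) module" where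
  "quotient_module R I J =
    \<lparr>carrier = (\<lambda>x. J +>\<^bsub>R\<^esub> x) ` I, monoid.mult = rcoset_mult R J, one = J +>\<^bsub>R\<^esub> \<one>\<^bsub>R\<^esub>,
      zero = J, add = set_add R, module.smult = rcoset_mult R J\<rparr>"

lemma (in local_ring) quotient_module_smult:
  assumes I: "ideal I R" and J: "ideal J R"
    and mI: "\<And>a x. \<lbrakk>a \<in> \<mm>; x \<in> I\<rbrakk> \<Longrightarrow> a \<otimes> x \<in> J"
    and a: "a \<in> carrier R" and x: "x \<in> I"
  shows "(\<mm> +> a) \<odot>\<^bsub>quotient_module R I J\<^esub> (J +> x) = J +> a \<otimes> x"
proof -
  interpret m: maximalideal \<mm> R by (rule maximal)
  interpret I: ideal I R by (rule I)
  interpret J: ideal J R by (rule J)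
  have xc: "x \<in> carrier R" using x I.Icarr by blast
  have 1: "J +> a' \<otimes> x' = J +> a \<otimes> x" if a': "a' \<in> \<mm> +> a" and x': "x' \<in> J +> x" for a' x'
  proof -
    from a' obtain u where u: "u \<in> \<mm>" "a' = u \<oplus> a" by (auto simp: a_r_coset_def')
    from x' obtain j where j: "j \<in> J" "x' = j \<oplus> x" by (auto simp: a_r_coset_def')
    have uc: "u \<in> carrier R" and jc: "j \<in> carrier R"
      using u j m.Icarr J.Icarr by blast+
    have "a' \<otimes> x' = (u \<otimes> j \<oplus> u \<otimes> x \<oplus> a \<otimes> j) \<oplus> a \<otimes> x"
      unfolding u(2) j(2) using uc jc a xc by (simp add: l_distr r_distr a_assoc a_lcomm)
    moreover have "u \<otimes> j \<in> J" "u \<otimes> x \<in> J" "a \<otimes> j \<in> J"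
      using u j x mI J.I_l_closed uc a by blast+
    then have "u \<otimes> j \<oplus> u \<otimes> x \<oplus> a \<otimes> j \<in> J" using J.a_closed by blast
    ultimately have "a' \<otimes> x' \<in> J +> a \<otimes> x" by (auto simp: a_r_coset_def')
    then show ?thesis using a_repr_independence[of "a' \<otimes> x'" J] a xc J.a_subgroup by simp
  qed
  have "a \<in> \<mm> +> a" "x \<in> J +> x" using m.a_rcos_self J.a_rcos_self a xc by blast+
  with 1 have "(\<Union>a'\<in>\<mm> +> a. \<Union>x'\<in>J +> x. J +> a' \<otimes> x') = J +> a \<otimes> x" by blast
  then show ?thesis by (simp only: quotient_module_def rcoset_mult_def module.simps)
qed

lemma (in local_ring) quotient_module_vectorspace:
  assumes I: "ideal I R" and J: "ideal J R"
    and mI: "\<And>a x. \<lbrakk>a \<in> \<mm>; x \<in> I\<rbrakk> \<Longrightarrow> a \<otimes> x \<in> J"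
  shows "vectorspace (R Quot \<mm>) (quotient_module R I J)"
proof -
  interpret m: maximalideal \<mm> R by (rule maximal)
  interpret I: ideal I R by (rule I)
  interpret J: ideal J R by (rule J)
  let ?V = "quotient_module R I J"
  have F: "field (R Quot \<mm>)" by (rule m.quotient_is_field) (rule is_cring)
  then interpret k: field "R Quot \<mm>" .
  have cV: "carrier ?V = (\<lambda>x. J +> x) ` I" by (simp add: quotient_module_def)
  have ck: "carrier (R Quot \<mm>) = (\<lambda>x. \<mm> +> x) ` carrier R"
    by (auto simp: FactRing_def A_RCOSETS_def')
  have addV: "(J +> x) \<oplus>\<^bsub>?V\<^esub> (J +> y) = J +> (x \<oplus> y)" if "x \<in> I" "y \<in> I" for x y
    using that I.Icarr by (simp add: quotient_module_def J.a_rcos_sum)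
  have zV: "\<zero>\<^bsub>?V\<^esub> = J +> \<zero>"
    using J.a_rcos_const[OF J.zero_closed] by (simp add: quotient_module_def)
  note sm = quotient_module_smult[OF I J mI]
  have addk: "(\<mm> +> x) \<oplus>\<^bsub>R Quot \<mm>\<^esub> (\<mm> +> y) = \<mm> +> (x \<oplus> y)"
    if "x \<in> carrier R" "y \<in> carrier R" for x y
    using that by (simp add: FactRing_def m.a_rcos_sum)
  have multk: "(\<mm> +> x) \<otimes>\<^bsub>R Quot \<mm>\<^esub> (\<mm> +> y) = \<mm> +> (x \<otimes> y)"
    if "x \<in> carrier R" "y \<in> carrier R" for x y
    using that by (simp add: FactRing_def m.rcoset_mult_add)
  have onek: "\<one>\<^bsub>R Quot \<mm>\<^esub> = \<mm> +> \<one>" by (simp add: FactRing_def)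
  have "abelian_group ?V"
  proof (rule abelian_groupI)
    fix X Y Z assume "X \<in> carrier ?V" "Y \<in> carrier ?V" "Z \<in> carrier ?V"
    then obtain x y z where X: "X = J +> x" "x \<in> I" and Y: "Y = J +> y" "y \<in> I"
      and Z: "Z = J +> z" "z \<in> I"
      unfolding cV by blast
    have xc: "x \<in> carrier R" "y \<in> carrier R" "z \<in> carrier R"
      using X Y Z I.Icarr by blast+
    have xI: "x \<oplus> y \<in> I" "y \<oplus> z \<in> I" using X Y Z I.a_closed by blast+
    show "X \<oplus>\<^bsub>?V\<^esub> Y \<in> carrier ?V"
      using X Y xI unfolding cV by (simp only: addV) blast
    show "X \<oplus>\<^bsub>?V\<^esub> Y \<oplus>\<^bsub>?V\<^esub> Z = X \<oplus>\<^bsub>?V\<^esub> (Y \<oplus>\<^bsub>?V\<^esub> Z)"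
      using X Y Z xI xc by (simp only: addV a_assoc)
    show "X \<oplus>\<^bsub>?V\<^esub> Y = Y \<oplus>\<^bsub>?V\<^esub> X"
      using X Y a_comm[OF xc(1,2)] by (simp only: addV)
  next
    show "\<zero>\<^bsub>?V\<^esub> \<in> carrier ?V" unfolding zV cV using I.zero_closed by blast
  next
    fix X assume "X \<in> carrier ?V"
    then obtain x where X: "X = J +> x" "x \<in> I" unfolding cV by blast
    then have xc: "x \<in> carrier R" using I.Icarr by blast
    show "\<zero>\<^bsub>?V\<^esub> \<oplus>\<^bsub>?V\<^esub> X = X"
      unfolding zV X(1) addV[OF I.zero_closed X(2)] l_zero[OF xc] ..
    have mx: "\<ominus> x \<in> I" using X(2) by (rule I.a_inv_closed)
    have "(J +> \<ominus> x) \<oplus>\<^bsub>?V\<^esub> X = \<zero>\<^bsub>?V\<^esub>"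
      unfolding X(1) addV[OF mx X(2)] zV l_neg[OF xc] ..
    then show "\<exists>Y\<in>carrier ?V. Y \<oplus>\<^bsub>?V\<^esub> X = \<zero>\<^bsub>?V\<^esub>" using mx unfolding cV by blast
  qed
  then have "Module.module (R Quot \<mm>) ?V"
  proof (rule moduleI[OF k.is_cring])
    fix A B X Y
    assume "A \<in> carrier (R Quot \<mm>)" "B \<in> carrier (R Quot \<mm>)" "X \<in> carrier ?V" "Y \<in> carrier ?V"
    then obtain a b x y where A: "A = \<mm> +> a" "a \<in> carrier R" and B: "B = \<mm> +> b" "b \<in> carrier R"
      and X: "X = J +> x" "x \<in> I" and Y: "Y = J +> y" "y \<in> I"
      unfolding ck cV by blast
    have xc: "x \<in> carrier R" "y \<in> carrier R" using X Y I.Icarr by blast+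
    have ax: "a \<otimes> x \<in> I" "a \<otimes> y \<in> I" "b \<otimes> x \<in> I" "x \<oplus> y \<in> I"
      using A B X Y I.I_l_closed I.a_closed by blast+
    show "A \<odot>\<^bsub>?V\<^esub> X \<in> carrier ?V"
      using A X ax unfolding cV by (simp only: sm) blast
    show "(A \<oplus>\<^bsub>R Quot \<mm>\<^esub> B) \<odot>\<^bsub>?V\<^esub> X = A \<odot>\<^bsub>?V\<^esub> X \<oplus>\<^bsub>?V\<^esub> B \<odot>\<^bsub>?V\<^esub> X"
      using A B X ax xc by (simp only: addk sm addV add.m_closed l_distr)
    show "A \<odot>\<^bsub>?V\<^esub> (X \<oplus>\<^bsub>?V\<^esub> Y) = A \<odot>\<^bsub>?V\<^esub> X \<oplus>\<^bsub>?V\<^esub> A \<odot>\<^bsub>?V\<^esub> Y"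
      using A X Y ax xc by (simp only: sm addV r_distr)
    show "(A \<otimes>\<^bsub>R Quot \<mm>\<^esub> B) \<odot>\<^bsub>?V\<^esub> X = A \<odot>\<^bsub>?V\<^esub> (B \<odot>\<^bsub>?V\<^esub> X)"
      using A B X ax xc by (simp only: multk sm m_closed m_assoc)
  next
    fix X assume "X \<in> carrier ?V"
    then obtain x where X: "X = J +> x" "x \<in> I" unfolding cV by blast
    then have "x \<in> carrier R" using I.Icarr by blast
    with X show "\<one>\<^bsub>R Quot \<mm>\<^esub> \<odot>\<^bsub>?V\<^esub> X = X" by (simp only: onek sm one_closed l_one)
  qed
  with F show ?thesis by (simp only: vectorspace_def)
qed

definition residue_dim ::
    "('a, 'b) ring_scheme \<Rightarrow> 'a set \<Rightarrow> 'a set \<Rightarrow> 'a set \<Rightarrow> nat" where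
  "residue_dim R \<mm> I J = vectorspace.dim (R Quot \<mm>) (quotient_module R I J)"

definition embedding_dim :: "('a, 'b) ring_scheme \<Rightarrow> 'a set \<Rightarrow> nat" where
  "embedding_dim R \<mm> = residue_dim R \<mm> \<mm> (ideal_power R \<mm> 2)"

definition hilbert_fun :: "('a, 'b) ring_scheme \<Rightarrow> 'a set \<Rightarrow> nat \<Rightarrow> nat" where
  "hilbert_fun R \<mm> i = residue_dim R \<mm> (ideal_power R \<mm> i) (ideal_power R \<mm> (i + 1))"

text \<open>
  The binomial coefficient \<open>binom ((e - 1) + i) i\<close>. With the truncated subtraction of the
  naturals, \<open>e + i - 1\<close> gives the right value also for \<open>e = 0\<close>, namely \<open>1\<close> for \<open>i = 0\<close>
  and \<open>0\<close> otherwise, whereas \<open>(e - 1) + i\<close> would not.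
\<close>

definition shifted_binomial :: "nat \<Rightarrow> nat \<Rightarrow> nat" where
  "shifted_binomial e i = (e + i - 1) choose i"

lemma shifted_binomial_gbinomial:
  "of_nat (shifted_binomial e i) = ((of_nat e - 1 + of_nat i) gchoose i :: rat)"
proof (cases "e + i = 0")
  case False
  then have "(of_nat e - 1 + of_nat i :: rat) = of_nat (e + i - 1)"
    by (cases e; cases i) simp_all
  then show ?thesis by (simp add: shifted_binomial_def binomial_gbinomial)
qed (simp add: shifted_binomial_def)

text \<open>The value is \<open>\<infinity>\<close> if the set is empty, e.g. if \<open>R\<close> is a field.\<close>

definition v_invariant :: "('a, 'b) ring_scheme \<Rightarrow> 'a set \<Rightarrow> enat" where
  "v_invariant R \<mm> =
    Inf {enat i | i. hilbert_fun R \<mm> i < shifted_binomial (embedding_dim R \<mm>) i}"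

definition socle :: "('a, 'b) ring_scheme \<Rightarrow> 'a set \<Rightarrow> 'a set" where
  "socle R \<mm> = {x \<in> carrier R. \<forall>a\<in>\<mm>. a \<otimes>\<^bsub>R\<^esub> x = \<zero>\<^bsub>R\<^esub>}"

definition top_socle_degree :: "('a, 'b) ring_scheme \<Rightarrow> 'a set \<Rightarrow> nat" where
  "top_socle_degree R \<mm> = (GREATEST s. ideal_power R \<mm> s \<noteq> {\<zero>\<^bsub>R\<^esub>})"

definition socle_coeff :: "('a, 'b) ring_scheme \<Rightarrow> 'a set \<Rightarrow> nat \<Rightarrow> nat" where
  "socle_coeff R \<mm> i = residue_dim R \<mm>
    (socle R \<mm> \<inter> ideal_power R \<mm> i) (socle R \<mm> \<inter> ideal_power R \<mm> (i + 1))"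

definition socle_polynomial :: "('a, 'b) ring_scheme \<Rightarrow> 'a set \<Rightarrow> nat poly" where
  "socle_polynomial R \<mm> = (\<Sum>i=0..top_socle_degree R \<mm>. monom (socle_coeff R \<mm> i) i)"

definition compressed_local_artinian_ring :: "('a, 'b) ring_scheme \<Rightarrow> 'a set \<Rightarrow> bool" where
  "compressed_local_artinian_ring R \<mm> \<longleftrightarrow>
    local_artinian_ring R \<mm> \<and>
    (let e = embedding_dim R \<mm>; s = top_socle_degree R \<mm>; c = socle_coeff R \<mm> in
      \<forall>i\<in>{0..s}. hilbert_fun R \<mm> i =
        min (shifted_binomial e i) (\<Sum>l=i..s. c l * shifted_binomial e (l - i)))"

text \<open>The length of a module is the supremum of the lengths of chains of submodules.\<close>

definition module_length :: "('a, 'b) ring_scheme \<Rightarrow> ('a, 'c, 'd) module_scheme \<Rightarrow> enat" where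
  "module_length R M = Sup {enat n | n N.
    (\<forall>i\<le>n. LinearCombinations.submodule R (N i) M) \<and> (\<forall>i<n. N i \<subset> N (Suc i))}"

definition regular_module :: "('a, 'b) ring_scheme \<Rightarrow> ('a, 'a) module" where
  "regular_module R =
    \<lparr>carrier = carrier R, monoid.mult = monoid.mult R, one = one R, zero = zero R, add = add R,
      module.smult = monoid.mult R\<rparr>"

lemma (in cring) regular_module_module: "Module.module R (regular_module R)"
  by (intro Module.module.intro Module.module_axioms.intro is_cring abelian_groupI)
    (auto simp: regular_module_def a_ac m_assoc l_distr r_distr intro: l_neg)

end

theory Submission
  imports Defs
begin

text \<open>
  The bound holds degree by degree, so that the length \<open>\<Sum>\<^sub>i H(i)\<close>, where \<open>H\<close> is the Hilbert function,
  attains the bound iff each \<open>H(i)\<close> does.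

  Let \<open>N(e, j) = binom (e - 1 + j) j\<close>. Modulo \<open>\<mm>\<^sup>j\<^sup>+\<^sup>1\<close>, every ideal of \<open>R\<close> is generated by at most
  \<open>N(e, j)\<close> elements. For the ideal \<open>\<mm>\<^sup>i\<close> this is the bound \<open>H(i) \<le> N(e, i)\<close>. If \<open>R/q\<close> is Gorenstein of socle
  degree at most \<open>l\<close>, then \<open>X \<mapsto> q : X\<close> is a duality; it turns a pair \<open>Y \<subseteq> X\<close> of ideals with
  \<open>\<mm>X \<subseteq> Y\<close> and \<open>X \<subseteq> \<mm>\<^sup>i + q\<close> into an ideal \<open>A = q : Y\<close> with \<open>\<mm>A + \<mm>\<^sup>l\<^sup>-\<^sup>i\<^sup>+\<^sup>1 \<subseteq> q : X\<close>, so that the length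
  of \<open>X/Y\<close> is at most \<open>N(e, l - i)\<close>. The zero ideal is the intersection of such irreducible ideals \<open>q\<close>,
  with \<open>c\<^sub>l\<close> of them belonging to the degree \<open>l\<close>; cutting \<open>R\<close> down by them one by one gives
  \<open>H(i) \<le> \<Sum>\<^sub>l c\<^sub>l N(e, l - i)\<close>. If \<open>R\<close> is compressed, then in degree \<open>v = v(R)\<close> the minimum is the sum,
  which is at least \<open>N(e, s - v)\<close>, and \<open>N(e, s - v) < N(e, v)\<close> forces \<open>s - v < v\<close>.
\<close>

no_notation Sum_Type.Plus (infixr \<open><+>\<close> 65)

section \<open>Composition series of ideals\<close>

lemma (in noetherian_ring) maximal_element_exists:
  assumes "A \<noteq> {}" and "\<And>I. I \<in> A \<Longrightarrow> ideal I R"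
  shows "\<exists>M\<in>A. \<forall>I\<in>A. M \<subseteq> I \<longrightarrow> I = M"
proof (rule subset_Zorn)
  fix C assume C: "subset.chain A C"
  show "\<exists>U\<in>A. \<forall>X\<in>C. X \<subseteq> U"
  proof (cases "C = {}")
    case False
    have "subset.chain {I. ideal I R} C"
      using C assms(2) by (auto simp: subset_chain_def)
    then have "\<Union>C \<in> C" using ideal_chain_is_trivial False by blast
    then show ?thesis using C by (auto simp: subset_chain_def)
  qed (use assms(1) in auto)
qed

lemma (in ring) ideal_minus_closed:
  assumes "ideal I R" "x \<in> I" "y \<in> I"
  shows "x \<ominus> y \<in> I"
proof -
  interpret I: ideal I R by fact
  show ?thesis unfolding a_minus_def by (intro I.a_closed I.a_inv_closed assms)
qed

lemma (in ring) ideal_sum_subset: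
  assumes "ideal K R" "I \<subseteq> K" "J \<subseteq> K"
  shows "I <+> J \<subseteq> K"
proof -
  interpret K: ideal K R by fact
  show ?thesis using assms(2,3) by (auto simp: set_add_def')
qed

lemma (in ring) subset_ideal_sum:
  assumes I: "ideal I R" and J: "ideal J R"
  shows "I \<subseteq> I <+> J" "J \<subseteq> I <+> J"
proof -
  interpret I: ideal I R by fact
  interpret J: ideal J R by fact
  show "I \<subseteq> I <+> J"
  proof
    fix x assume "x \<in> I"
    then have "x = x \<oplus> \<zero>" using I.Icarr by simp
    then show "x \<in> I <+> J" using \<open>x \<in> I\<close> J.zero_closed unfolding set_add_def' by blast
  qed
  show "J \<subseteq> I <+> J"
  proof
    fix x assume "x \<in> J"
    then have "x = \<zero> \<oplus> x" using J.Icarr by simp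
    then show "x \<in> I <+> J" using \<open>x \<in> J\<close> I.zero_closed unfolding set_add_def' by blast
  qed
qed

lemma (in cring) mem_ideal_sum_cgenideal:
  "z \<in> J <+> PIdl x \<longleftrightarrow> (\<exists>j\<in>J. \<exists>b\<in>carrier R. z = j \<oplus> b \<otimes> x)"
  by (auto simp: set_add_def' cgenideal_def)

lemma (in cring) cgenideal_subset:
  assumes "ideal I R" "x \<in> I" shows "PIdl x \<subseteq> I"
proof -
  interpret I: ideal I R by fact
  show ?thesis using assms(2) I.I_l_closed by (auto simp: cgenideal_def)
qed

section \<open>Local rings and simple quotients of ideals\<close>

context local_ring
begin

sublocale m: maximalideal \<mm> R by (rule maximal)

text \<open>If \<open>PIdl a\<close> were proper, a maximal element among the proper ideals above
  it, which exists by the Noetherian property, would be a maximal ideal, hence \<mm>, and would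
  contain \<open>a\<close>.\<close>

lemma exists_inverse_outside_maximal:
  assumes a: "a \<in> carrier R" "a \<notin> \<mm>"
  shows "\<exists>b\<in>carrier R. b \<otimes> a = \<one>"
proof -
  have "PIdl a = carrier R"
  proof (rule ccontr)
    assume ne: "PIdl a \<noteq> carrier R"
    let ?A = "{I. ideal I R \<and> PIdl a \<subseteq> I \<and> I \<noteq> carrier R}"
    have "PIdl a \<in> ?A" using ne cgenideal_ideal[OF a(1)] by blast
    then obtain M where M: "M \<in> ?A" and max: "\<And>I. I \<in> ?A \<Longrightarrow> M \<subseteq> I \<Longrightarrow> I = M"
      using maximal_element_exists[of ?A] by (metis (no_types, lifting) empty_iff mem_Collect_eq)
    have "maximalideal M R"
    proof (rule maximalidealI)
      fix J assume "ideal J R" "M \<subseteq> J" "J \<subseteq> carrier R"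
      then show "J = M \<or> J = carrier R" using M max[of J] by blast
    qed (use M in auto)
    then have "M = \<mm>" by (rule unique_maximal)
    then show False using M a cgenideal_self[OF a(1)] by blast
  qed
  then have "\<one> \<in> PIdl a" by simp
  then show ?thesis by (auto simp: cgenideal_def)
qed

lemma proper_ideal_subset_maximal:
  assumes I: "ideal I R" and "I \<noteq> carrier R"
  shows "I \<subseteq> \<mm>"
proof
  interpret I: ideal I R by fact
  fix a assume a: "a \<in> I"
  show "a \<in> \<mm>"
  proof (rule ccontr)
    assume "a \<notin> \<mm>"
    then obtain b where "b \<in> carrier R" "b \<otimes> a = \<one>"
      using exists_inverse_outside_maximal a I.Icarr by blast
    then have "\<one> \<in> I" using a I.I_l_closed[of a b] by simp
    then show False using I.one_imp_carrier assms(2) by blast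
  qed
qed

text \<open>\<open>I/J\<close> is a simple module.\<close>

definition cover :: "'a set \<Rightarrow> 'a set \<Rightarrow> bool" where
  "cover J I \<longleftrightarrow> ideal J R \<and> ideal I R \<and> J \<subset> I \<and> (\<forall>a\<in>\<mm>. \<forall>x\<in>I. a \<otimes> x \<in> J) \<and>
     (\<forall>y\<in>I - J. \<forall>z\<in>I. \<exists>j\<in>J. \<exists>b\<in>carrier R. z = j \<oplus> b \<otimes> y)"

text \<open>One generator suffices: if \<open>y = j \<oplus> b \<otimes> x\<close> lies outside
  \<open>J\<close>, then \<open>b\<close> lies outside \<mm>, so \<open>b\<close> is invertible and
  \<open>x\<close>, hence every element of \<open>I\<close>, can be rewritten in terms of
  \<open>y\<close> modulo \<open>J\<close>.\<close>

lemma coverI: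
  assumes J: "ideal J R" and I: "ideal I R" and sub: "J \<subseteq> I" and x: "x \<in> I" "x \<notin> J"
    and mx: "\<And>a. a \<in> \<mm> \<Longrightarrow> a \<otimes> x \<in> J"
    and gen: "\<And>z. z \<in> I \<Longrightarrow> \<exists>j\<in>J. \<exists>b\<in>carrier R. z = j \<oplus> b \<otimes> x"
  shows "cover J I"
proof -
  interpret J: ideal J R by fact
  interpret I: ideal I R by fact
  have xc: "x \<in> carrier R" using x I.Icarr by blast
  have 1: "a \<otimes> z \<in> J" if a: "a \<in> \<mm>" and z: "z \<in> I" for a z
  proof -
    obtain j b where j: "j \<in> J" "b \<in> carrier R" "z = j \<oplus> b \<otimes> x" using gen[OF z] by blast
    have "a \<otimes> z = a \<otimes> j \<oplus> b \<otimes> (a \<otimes> x)"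
      using j a xc m.Icarr[OF a] J.Icarr[OF j(1)] by (simp add: r_distr m_lcomm)
    moreover have "a \<otimes> j \<in> J" "b \<otimes> (a \<otimes> x) \<in> J"
      using j a mx m.Icarr[OF a] J.I_l_closed by blast+
    ultimately show ?thesis using J.a_closed by simp
  qed
  have 2: "\<exists>j\<in>J. \<exists>b\<in>carrier R. z = j \<oplus> b \<otimes> y" if y: "y \<in> I" "y \<notin> J" and z: "z \<in> I" for y z
  proof -
    obtain j b where j: "j \<in> J" "b \<in> carrier R" "y = j \<oplus> b \<otimes> x" using gen[OF y(1)] by blast
    obtain j2 b2 where j2: "j2 \<in> J" "b2 \<in> carrier R" "z = j2 \<oplus> b2 \<otimes> x" using gen[OF z] by blast
    have "b \<notin> \<mm>" using mx j y(2) J.a_closed by blast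
    then obtain b' where b': "b' \<in> carrier R" "b' \<otimes> b = \<one>"
      using exists_inverse_outside_maximal j by blast
    note jc = J.Icarr[OF j(1)] J.Icarr[OF j2(1)]
    have "b' \<otimes> y = b' \<otimes> j \<oplus> x"
      using j b' jc xc by (simp add: r_distr m_assoc[symmetric])
    then have "(b2 \<otimes> b') \<otimes> y = b2 \<otimes> (b' \<otimes> j) \<oplus> b2 \<otimes> x"
      using j2(2) b' jc xc I.Icarr[OF y(1)] by (simp add: r_distr m_assoc)
    moreover have "b2 \<otimes> (b' \<otimes> j) \<in> carrier R" "b2 \<otimes> x \<in> carrier R"
      using j2(2) b' jc xc by blast+
    ultimately have "(j2 \<ominus> b2 \<otimes> (b' \<otimes> j)) \<oplus> (b2 \<otimes> b') \<otimes> y = j2 \<oplus> b2 \<otimes> x"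
      using jc(2) by (simp only: a_minus_def a_assoc r_neg1 a_inv_closed a_closed)
    then have "z = (j2 \<ominus> b2 \<otimes> (b' \<otimes> j)) \<oplus> (b2 \<otimes> b') \<otimes> y"
      unfolding j2(3) by (rule sym)
    moreover have "j2 \<ominus> b2 \<otimes> (b' \<otimes> j) \<in> J"
      by (intro ideal_minus_closed[OF J] J.I_l_closed j j2 b')
    ultimately show ?thesis using j2(2) b'(1) by blast
  qed
  show ?thesis unfolding cover_def using J I sub x 1 2 by blast
qed

lemma coverD:
  assumes "cover J I"
  shows "ideal J R" "ideal I R" "J \<subset> I" "\<And>a x. a \<in> \<mm> \<Longrightarrow> x \<in> I \<Longrightarrow> a \<otimes> x \<in> J"
    "\<And>y z. y \<in> I \<Longrightarrow> y \<notin> J \<Longrightarrow> z \<in> I \<Longrightarrow> \<exists>j\<in>J. \<exists>b\<in>carrier R. z = j \<oplus> b \<otimes> y"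
  using assms unfolding cover_def by blast+

lemma cover_adjoin:
  assumes J: "ideal J R" and x: "x \<in> carrier R" "x \<notin> J" "\<And>a. a \<in> \<mm> \<Longrightarrow> a \<otimes> x \<in> J"
  shows "cover J (J <+> PIdl x)"
proof (rule coverI)
  have P: "ideal (PIdl x) R" using x by (intro cgenideal_ideal)
  then show "ideal (J <+> PIdl x) R" using J by (intro add_ideals)
  show "J \<subseteq> J <+> PIdl x" "x \<in> J <+> PIdl x"
    using subset_ideal_sum[OF J P] cgenideal_self x by auto
qed (use assms mem_ideal_sum_cgenideal in auto)

lemma cover_eq_adjoin:
  assumes c: "cover J I" and x: "x \<in> I" "x \<notin> J"
  shows "I = J <+> PIdl x"
proof
  note c = coverD[OF c]
  show "I \<subseteq> J <+> PIdl x" using c(5)[OF x] mem_ideal_sum_cgenideal by blast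
  show "J <+> PIdl x \<subseteq> I" using c x by (intro ideal_sum_subset cgenideal_subset) auto
qed

lemma cover_between:
  assumes "cover J I" "ideal K R" "J \<subseteq> K" "x \<in> K" "x \<in> I" "x \<notin> J"
  shows "I \<subseteq> K"
proof -
  have "J <+> PIdl x \<subseteq> K" using assms by (intro ideal_sum_subset cgenideal_subset)
  then show ?thesis using cover_eq_adjoin[OF assms(1,5,6)] by simp
qed

inductive composition :: "'a set \<Rightarrow> 'a set \<Rightarrow> nat \<Rightarrow> bool" for J where
  refl: "composition J J 0"
| step: "\<lbrakk>composition J K n; cover K I\<rbrakk> \<Longrightarrow> composition J I (Suc n)"

lemma composition_subset: "composition J I n \<Longrightarrow> J \<subseteq> I"
  by (induction rule: composition.induct) (auto dest: coverD(3))

text \<open>The Jordan--Hoelder argument: intersecting a composition series of \<open>I\<close> with \<open>J\<close> gives one of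
  \<open>J\<close> after removal of repetitions, and there are repetitions unless \<open>J = I\<close>.\<close>

lemma composition_subideal:
  assumes "composition Z I n" "ideal J R" "Z \<subseteq> J" "J \<subseteq> I"
  shows "\<exists>m\<le>n. composition Z J m \<and> (J \<noteq> I \<longrightarrow> m < n)"
  using assms
proof (induction arbitrary: J rule: composition.induct)
  case refl
  then have "J = Z" by blast
  then show ?case using composition.refl by simp
next
  case (step K n I)
  note c = coverD[OF step.hyps(2)]
  have JK: "ideal (J \<inter> K) R" by (rule i_intersect[OF step.prems(1) c(1)])
  have "Z \<subseteq> J \<inter> K" using step.prems(2) composition_subset[OF step.hyps(1)] by blast
  from step.IH[OF JK this] obtain m where m: "m \<le> n" "composition Z (J \<inter> K) m"
    "J \<inter> K \<noteq> K \<Longrightarrow> m < n" by blast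
  show ?case
  proof (cases "J \<subseteq> K")
    case True
    then have "J \<inter> K = J" by blast
    then show ?thesis using m(1,2) by (intro exI[of _ m]) auto
  next
    case False
    then obtain y where y: "y \<in> J" "y \<notin> K" by blast
    interpret J: ideal J R by (rule step.prems(1))
    \<comment> \<open>\<open>J/(J \<inter> K)\<close> embeds in the simple module \<open>I/K\<close>
      and is nonzero because of \<open>y\<close>.\<close>
    have "cover (J \<inter> K) J"
    proof (rule coverI[OF JK step.prems(1)])
      show "y \<in> J" "y \<notin> J \<inter> K" using y by auto
      show "a \<otimes> y \<in> J \<inter> K" if "a \<in> \<mm>" for a
        using that y c(4)[of a y] step.prems(3) J.I_l_closed[of y a] m.Icarr[of a] by blast
      fix z assume z: "z \<in> J"
      then obtain j b where j: "j \<in> K" "b \<in> carrier R" "z = j \<oplus> b \<otimes> y"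
        using c(5)[of y z] y step.prems(3) by blast
      have "j = z \<ominus> b \<otimes> y"
        using j J.Icarr[OF y(1)] ideal.Icarr[OF c(1) j(1)] by algebra
      then have "j \<in> J"
        using ideal_minus_closed[OF step.prems(1) z] J.I_l_closed[OF y(1) j(2)] by simp
      then show "\<exists>j\<in>J \<inter> K. \<exists>b\<in>carrier R. z = j \<oplus> b \<otimes> y" using j by blast
    qed auto
    then have "composition Z J (Suc m)" by (rule composition.step[OF m(2)])
    moreover have "Suc m < Suc n" if "J \<noteq> I"
    proof -
      \<comment> \<open>Otherwise \<open>K \<subseteq> J\<close>, and since \<open>y\<close> lies in
        \<open>J\<close> but not in \<open>K\<close>, simplicity of \<open>I/K\<close> would give
        \<open>I \<subseteq> J\<close>.\<close>
      have "J \<inter> K \<noteq> K"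
        using cover_between[OF step.hyps(2) step.prems(1) _ y(1)] y step.prems(3) that by blast
      then show ?thesis using m(3) by simp
    qed
    moreover have "Suc m \<le> Suc n" using m(1) by simp
    ultimately show ?thesis by blast
  qed
qed

end

section \<open>Existence of composition series and the length of an ideal\<close>

context local_artinian_ring
begin

lemma minimal_element_exists:
  assumes ne: "A \<noteq> {}" and A: "\<And>I. I \<in> A \<Longrightarrow> ideal I R"
  shows "\<exists>M\<in>A. \<forall>I\<in>A. I \<subseteq> M \<longrightarrow> I = M"
proof (rule ccontr)
  assume "\<not> ?thesis"
  then have *: "\<exists>I. I \<in> A \<and> I \<subset> M" if "M \<in> A" for M using that by blast
  have "\<exists>f. \<forall>n::nat. f n \<in> A \<and> f (Suc n) \<subset> f n"
    by (rule dependent_nat_choice) (use ne * in auto)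
  then obtain f :: "nat \<Rightarrow> 'a set" where f: "\<And>n. f n \<in> A" "\<And>n. f (Suc n) \<subset> f n" by blast
  then obtain N where "\<forall>n\<ge>N. f n = f N" using descending_chain[of f] A by blast
  then have "f (Suc N) = f N" by (meson le_SucI le_refl)
  then show False using f(2)[of N] by blast
qed

text \<open>A minimal ideal \<open>M\<close> with \<open>K \<subset> M \<subseteq> I\<close> is
  generated over \<open>K\<close> by any of its elements outside \<open>K\<close>. If
  \<open>x\<close> is such an element and \<open>a \<otimes> x\<close> with \<open>a\<close> in
  \<mm> were another, then \<open>x = k \<oplus> b \<otimes> (a \<otimes> x)\<close> with
  \<open>k\<close> in \<open>K\<close>; as \<open>\<one> \<ominus> b \<otimes> a\<close> is a unit,
  \<open>x\<close> would lie in \<open>K\<close>.\<close>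

lemma cover_exists:
  assumes K: "ideal K R" and I: "ideal I R" and KI: "K \<subset> I"
  shows "\<exists>I'. cover K I' \<and> I' \<subseteq> I"
proof -
  let ?A = "{L. ideal L R \<and> K \<subset> L \<and> L \<subseteq> I}"
  have "I \<in> ?A" using assms by blast
  then obtain M where M: "M \<in> ?A" and min: "\<And>L. L \<in> ?A \<Longrightarrow> L \<subseteq> M \<Longrightarrow> L = M"
    using minimal_element_exists[of ?A] by (metis (no_types, lifting) empty_iff mem_Collect_eq)
  then obtain x where x: "x \<in> M" "x \<notin> K" by blast
  interpret M: ideal M R using M by blast
  interpret K: ideal K R by fact
  have xc: "x \<in> carrier R" using x M.Icarr by blast
  have P: "ideal (PIdl y) R" "ideal (K <+> PIdl y) R" "K \<subseteq> K <+> PIdl y" "y \<in> K <+> PIdl y"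
    if "y \<in> carrier R" for y
    using that K subset_ideal_sum[OF K, of "PIdl y"] cgenideal_ideal cgenideal_self add_ideals
    by auto
  have sub: "K <+> PIdl y \<subseteq> M" if "y \<in> M" for y
    using that M by (intro ideal_sum_subset cgenideal_subset) auto
  have "K <+> PIdl x = M"
    using P[OF xc] sub[OF x(1)] M x by (intro min) auto
  moreover have "a \<otimes> x \<in> K" if a: "a \<in> \<mm>" for a
  proof (rule ccontr)
    assume n: "a \<otimes> x \<notin> K"
    have ac: "a \<in> carrier R" using a m.Icarr by blast
    have axM: "a \<otimes> x \<in> M" using ac x M.I_l_closed by blast
    then have axc: "a \<otimes> x \<in> carrier R" using M.Icarr by blast
    have "K <+> PIdl (a \<otimes> x) = M"
      using P[OF axc] sub[OF axM] M n by (intro min) auto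
    then obtain k b where kb: "k \<in> K" "b \<in> carrier R" "x = k \<oplus> b \<otimes> (a \<otimes> x)"
      using x(1) mem_ideal_sum_cgenideal by blast
    have kc: "k \<in> carrier R" using kb K.Icarr by blast
    have "k = x \<ominus> b \<otimes> (a \<otimes> x)"
      using kb(2) kc ac xc by (subst kb(3)) algebra
    then have k: "k = (\<one> \<ominus> b \<otimes> a) \<otimes> x"
      using kb(2) ac xc by (simp add: a_minus_def l_distr m_assoc l_minus)
    have "\<one> \<ominus> b \<otimes> a \<notin> \<mm>"
    proof
      assume "\<one> \<ominus> b \<otimes> a \<in> \<mm>"
      then have "(\<one> \<ominus> b \<otimes> a) \<oplus> b \<otimes> a \<in> \<mm>"
        using a kb m.I_l_closed m.a_closed by blast
      moreover have "(\<one> \<ominus> b \<otimes> a) \<oplus> b \<otimes> a = \<one>" using ac kb by algebra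
      ultimately show False using m.one_imp_carrier m.I_notcarr by simp
    qed
    then obtain u where u: "u \<in> carrier R" "u \<otimes> (\<one> \<ominus> b \<otimes> a) = \<one>"
      using exists_inverse_outside_maximal[of "\<one> \<ominus> b \<otimes> a"] ac kb by auto
    then have "u \<otimes> k = x" unfolding k using ac kb xc by (simp add: m_assoc[symmetric])
    then show False using x kb u K.I_l_closed by blast
  qed
  ultimately show ?thesis using cover_adjoin[OF K xc x(2)] M by auto
qed

text \<open>Among the ideals inside \<open>I\<close> reached from \<open>J\<close> by a composition
  series there is a maximal one; it is \<open>I\<close>, since otherwise \<open>cover_exists\<close>
  would prolong the series.\<close>

lemma composition_exists:
  assumes J: "ideal J R" and I: "ideal I R" and JI: "J \<subseteq> I"
  shows "\<exists>n. composition J I n"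
proof -
  let ?A = "{K. ideal K R \<and> K \<subseteq> I \<and> (\<exists>n. composition J K n)}"
  have "J \<in> ?A" using assms by (auto intro: composition.refl)
  then obtain M where M: "M \<in> ?A" and max: "\<And>L. L \<in> ?A \<Longrightarrow> M \<subseteq> L \<Longrightarrow> L = M"
    using maximal_element_exists[of ?A] by (metis (no_types, lifting) empty_iff mem_Collect_eq)
  have "M = I"
  proof (rule ccontr)
    assume "M \<noteq> I"
    then obtain I' where I': "cover M I'" "I' \<subseteq> I" using cover_exists[of M I] M I by auto
    then have "I' \<in> ?A" using M coverD(2)[OF I'(1)] by (auto intro: composition.step)
    then show False using max[of I'] coverD(3)[OF I'(1)] by blast
  qed
  then show ?thesis using M by blast
qed

text \<open>The length of \<open>I\<close> as a module. With \<open>LEAST\<close> the definition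
  does not presuppose that all composition series have the same length; this follows from
  \<open>rank_composition\<close> and \<open>rank_zero\<close>.\<close>

definition rank :: "'a set \<Rightarrow> nat" where
  "rank I = (LEAST n. composition {\<zero>} I n)"

lemma zero_subset_ideal: "ideal I R \<Longrightarrow> {\<zero>} \<subseteq> I"
  using additive_subgroup.zero_closed[OF ideal.axioms(1)] by blast

lemma composition_rank: "ideal I R \<Longrightarrow> composition {\<zero>} I (rank I)"
  unfolding rank_def using composition_exists[OF zeroideal _ zero_subset_ideal] by (metis LeastI)

lemma rank_le: "composition {\<zero>} I n \<Longrightarrow> rank I \<le> n"
  unfolding rank_def by (rule Least_le)

text \<open>The Jordan--Hoelder argument, applied to a shortest composition series of
  \<open>I\<close>, gives a strictly shorter one of \<open>J\<close>.\<close>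

lemma rank_less:
  assumes "ideal J R" "ideal I R" "J \<subset> I"
  shows "rank J < rank I"
proof -
  obtain m where "composition {\<zero>} J m" "J \<noteq> I \<longrightarrow> m < rank I"
    using composition_subideal[OF composition_rank[OF assms(2)] assms(1)
        zero_subset_ideal[OF assms(1)]] assms(3) by blast
  then show ?thesis using rank_le[of J m] assms(3) by auto
qed

lemma rank_mono: "\<lbrakk>ideal J R; ideal I R; J \<subseteq> I\<rbrakk> \<Longrightarrow> rank J \<le> rank I"
  by (metis rank_less less_imp_le psubsetI order_refl)

lemma rank_cover: "cover J I \<Longrightarrow> rank I = Suc (rank J)"
  using rank_less[OF coverD(1-3)] rank_le[OF composition.step[OF composition_rank[OF coverD(1)]]]
  by (metis Suc_leI le_antisym)

lemma rank_composition: "composition J I n \<Longrightarrow> rank I = rank J + n"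
  by (induction rule: composition.induct) (auto simp: rank_cover)

lemma rank_zero [simp]: "rank {\<zero>} = 0"
  using rank_le[OF composition.refl] by simp

text \<open>Second isomorphism theorem: adding \<open>B\<close> to the members of a composition
  series from \<open>A \<inter> B\<close> to \<open>A\<close> yields one from \<open>B\<close> to
  \<open>A <+> B\<close>, of the same length.\<close>

lemma rank_modular:
  assumes A: "ideal A R" and B: "ideal B R"
  shows "rank (A <+> B) + rank (A \<inter> B) = rank A + rank B"
proof -
  interpret B: ideal B R by fact
  have AB: "ideal (A \<inter> B) R" using i_intersect[OF A B] .
  have "rank (K <+> B) = rank B + n" if "composition (A \<inter> B) K n" "K \<subseteq> A" for K n
    using that
  proof (induction rule: composition.induct)
    case refl
    have "(A \<inter> B) <+> B = B"
      using ideal_sum_subset[OF B, of "A \<inter> B" B] subset_ideal_sum[OF AB B] by blast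
    then show ?case by simp
  next
    case (step K n K')
    note c = coverD[OF step.hyps(2)]
    interpret K: ideal K R by (rule c(1))
    interpret K': ideal K' R by (rule c(2))
    obtain x where x: "x \<in> K'" "x \<notin> K" using c(3) by blast
    have i: "ideal (K <+> B) R" "ideal (K' <+> B) R" using c(1,2) B by (auto intro: add_ideals)
    have "cover (K <+> B) (K' <+> B)"
    proof (rule coverI[OF i])
      show "K <+> B \<subseteq> K' <+> B" using c(3) by (auto simp: set_add_def')
      show "x \<in> K' <+> B" using x subset_ideal_sum[OF c(2) B] by blast
      \<comment> \<open>The step stays strict because
        \<open>K' \<inter> B \<subseteq> A \<inter> B \<subseteq> K\<close>.\<close>
      show "x \<notin> K <+> B"
      proof
        assume "x \<in> K <+> B"
        then obtain k b where kb: "k \<in> K" "b \<in> B" "x = k \<oplus> b" by (auto simp: set_add_def')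
        have "b = x \<ominus> k" using kb(3) K.Icarr[OF kb(1)] B.Icarr[OF kb(2)] a_comm[of k b]
            by (simp add: a_minus_def a_assoc r_neg)
        moreover have "k \<in> K'" using kb c(3) by blast
        ultimately have "b \<in> K'" using ideal_minus_closed[OF c(2) x(1)] by simp
        then have "b \<in> K" using step.prems kb(2) composition_subset[OF step.hyps(1)] by blast
        then show False using kb x K.a_closed by blast
      qed
      show "a \<otimes> x \<in> K <+> B" if "a \<in> \<mm>" for a
        using that x c(4)[of a x] subset_ideal_sum[OF c(1) B] by blast
      fix z assume "z \<in> K' <+> B"
      then obtain k b where kb: "k \<in> K'" "b \<in> B" "z = k \<oplus> b" by (auto simp: set_add_def')
      obtain j r where jr: "j \<in> K" "r \<in> carrier R" "k = j \<oplus> r \<otimes> x" using c(5)[OF x kb(1)] by blast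
      have "z = (j \<oplus> b) \<oplus> r \<otimes> x" unfolding kb(3) jr(3)
        using K.Icarr[OF jr(1)] B.Icarr[OF kb(2)] jr(2) K'.Icarr[OF x(1)] by algebra
      moreover have "j \<oplus> b \<in> K <+> B" using jr kb by (auto simp: set_add_def')
      ultimately show "\<exists>j\<in>K <+> B. \<exists>b\<in>carrier R. z = j \<oplus> b \<otimes> x" using jr by blast
    qed
    moreover have "K \<subseteq> A" using step.prems c(3) by blast
    ultimately show ?case using step.IH by (simp add: rank_cover)
  qed
  moreover obtain n where "composition (A \<inter> B) A n"
    using composition_exists[OF AB A Int_lower1] by blast
  ultimately show ?thesis using rank_composition[of "A \<inter> B" A n] by simp
qed

section \<open>Dimensions and lengths\<close>

text \<open>Links vector space dimension with length. Each step from \<open>K\<close> to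
  \<open>K'\<close> adds the class of one \<open>x\<close> in \<open>K' - K\<close>: it is outside
  the image of \<open>K\<close> because \<open>J \<subseteq> K\<close>, and together with that image
  it spans the image of \<open>K'\<close> because \<open>K'/K\<close> is simple.\<close>

lemma quotient_module_composition_basis:
  assumes I: "ideal I R" and J: "ideal J R"
    and mI: "\<And>a x. \<lbrakk>a \<in> \<mm>; x \<in> I\<rbrakk> \<Longrightarrow> a \<otimes> x \<in> J"
    and "composition J K n" "K \<subseteq> I"
  shows "\<exists>B\<subseteq>carrier (quotient_module R I J). finite B \<and> card B = n \<and>
    \<not> module.lin_dep (R Quot \<mm>) (quotient_module R I J) B \<and>
    LinearCombinations.module.span (R Quot \<mm>) (quotient_module R I J) B = (\<lambda>x. J +> x) ` K"
  using assms(4,5)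
proof (induction rule: composition.induct)
  case refl
  interpret V: vectorspace "R Quot \<mm>" "quotient_module R I J"
    by (rule quotient_module_vectorspace[OF I J mI])
  interpret J: ideal J R by fact
  have "(\<lambda>x. J +> x) ` J = {J}"
    using J.a_rcos_const J.zero_closed by (metis (no_types, lifting) equals0D image_cong image_constant_conv)
  moreover have "\<zero>\<^bsub>quotient_module R I J\<^esub> = J" by (simp add: quotient_module_def)
  ultimately show ?case
    using V.span_empty by (intro exI[of _ "{}"]) (auto simp: V.lin_dep_def)
next
  case (step K n K')
  let ?V = "quotient_module R I J"
  interpret V: vectorspace "R Quot \<mm>" ?V
    by (rule quotient_module_vectorspace[OF I J mI])
  interpret I: ideal I R by fact
  interpret J: ideal J R by fact
  note c = coverD[OF step.hyps(2)]
  interpret K: ideal K R by (rule c)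
  interpret K': ideal K' R by (rule c)
  have JK: "J \<subseteq> K" using composition_subset[OF step.hyps(1)] .
  obtain B where B: "B \<subseteq> carrier ?V" "finite B" "card B = n" "\<not> V.lin_dep B"
    "V.span B = (\<lambda>x. J +> x) ` K"
    using step.IH step.prems c(3) by blast
  obtain x where x: "x \<in> K'" "x \<notin> K" using c by blast
  have xc: "x \<in> carrier R" using x K'.Icarr by blast
  let ?v = "J +> x"
  have cV: "carrier ?V = (\<lambda>x. J +> x) ` I" by (simp add: quotient_module_def)
  have ck: "carrier (R Quot \<mm>) = (\<lambda>x. \<mm> +> x) ` carrier R"
    by (auto simp: FactRing_def A_RCOSETS_def')
  have addV: "(J +> y) \<oplus>\<^bsub>?V\<^esub> (J +> z) = J +> (y \<oplus> z)" if "y \<in> I" "z \<in> I" for y z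
    using that I.Icarr by (simp add: quotient_module_def J.a_rcos_sum)
  have zV: "\<zero>\<^bsub>?V\<^esub> = J +> \<zero>"
    using J.a_rcos_const[OF J.zero_closed] by (simp add: quotient_module_def)
  note sm = quotient_module_smult[OF I J mI]
  have v: "?v \<in> carrier ?V" using x step.prems unfolding cV by blast
  have vspan: "?v \<notin> V.span B"
  proof
    assume "?v \<in> V.span B"
    then obtain y where y: "y \<in> K" "J +> x = J +> y" using B by blast
    then have "x \<in> J +> y" using J.a_rcos_self[OF xc] by simp
    then show False using y x JK K.a_closed by (auto simp: a_r_coset_def')
  qed
  then have vB: "?v \<notin> B" using V.in_own_span[OF B(1)] by blast
  let ?B = "B \<union> {?v}"
  have Bc: "?B \<subseteq> carrier ?V" using B v by blast
  have li: "\<not> V.lin_dep ?B"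
    using V.lin_dep_iff_in_span[OF B(1,4) v vB] vspan by blast
  have "V.span ?B = (\<lambda>x. J +> x) ` K'"
  proof
    have "LinearCombinations.submodule (R Quot \<mm>) ((\<lambda>x. J +> x) ` K') ?V"
      unfolding LinearCombinations.submodule_def
    proof (intro conjI allI impI)
      show "Module.module (R Quot \<mm>) ?V" by (rule V.module_axioms)
      show "(\<lambda>x. J +> x) ` K' \<subseteq> carrier ?V" unfolding cV using step.prems by blast
      show "\<zero>\<^bsub>?V\<^esub> \<in> (\<lambda>x. J +> x) ` K'" unfolding zV using K'.zero_closed by blast
      fix u w assume "u \<in> (\<lambda>x. J +> x) ` K'" "w \<in> (\<lambda>x. J +> x) ` K'"
      then obtain y z where "y \<in> K'" "z \<in> K'" "u = J +> y" "w = J +> z" by blast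
      then show "u \<oplus>\<^bsub>?V\<^esub> w \<in> (\<lambda>x. J +> x) ` K'"
        using step.prems addV[of y z] K'.a_closed by blast
    next
      fix A w assume "A \<in> carrier (R Quot \<mm>)" "w \<in> (\<lambda>x. J +> x) ` K'"
      then obtain a z where "a \<in> carrier R" "A = \<mm> +> a" "z \<in> K'" "w = J +> z"
        unfolding ck by blast
      then show "A \<odot>\<^bsub>?V\<^esub> w \<in> (\<lambda>x. J +> x) ` K'"
        using step.prems sm[of a z] K'.I_l_closed by blast
    qed
    moreover have "?B \<subseteq> (\<lambda>x. J +> x) ` K'"
      using V.in_own_span[OF B(1)] B(5) c(3) x by blast
    ultimately show "V.span ?B \<subseteq> (\<lambda>x. J +> x) ` K'" by (intro V.span_is_subset)
    show "(\<lambda>x. J +> x) ` K' \<subseteq> V.span ?B"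
    proof
      fix w assume "w \<in> (\<lambda>x. J +> x) ` K'"
      then obtain z where z: "z \<in> K'" "w = J +> z" by blast
      obtain k b where kb: "k \<in> K" "b \<in> carrier R" "z = k \<oplus> b \<otimes> x" using c(5)[OF x z(1)] by blast
      have S: "LinearCombinations.submodule (R Quot \<mm>) (V.span ?B) ?V"
        by (rule V.span_is_submodule[OF Bc])
      have "J +> k \<in> V.span ?B"
        using kb B(5) V.span_is_monotone[of B ?B] by blast
      moreover have "?v \<in> V.span ?B" using V.in_own_span[OF Bc] by blast
      then have "(\<mm> +> b) \<odot>\<^bsub>?V\<^esub> ?v \<in> V.span ?B"
        using S kb(2) unfolding LinearCombinations.submodule_def ck by blast
      ultimately have "(J +> k) \<oplus>\<^bsub>?V\<^esub> ((\<mm> +> b) \<odot>\<^bsub>?V\<^esub> ?v) \<in> V.span ?B"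
        using S unfolding LinearCombinations.submodule_def by blast
      moreover have "x \<in> I" "k \<in> I" "b \<otimes> x \<in> I"
        using kb x step.prems c(3) I.I_l_closed by blast+
      ultimately show "w \<in> V.span ?B" unfolding z(2) kb(3) using sm[of b x] addV kb by simp
    qed
  qed
  then show ?case using Bc li B vB by (intro exI[of _ ?B]) simp
qed

lemma residue_dim_rank:
  assumes I: "ideal I R" and J: "ideal J R" and JI: "J \<subseteq> I"
    and mI: "\<And>a x. \<lbrakk>a \<in> \<mm>; x \<in> I\<rbrakk> \<Longrightarrow> a \<otimes> x \<in> J"
  shows "rank I = rank J + residue_dim R \<mm> I J"
proof -
  obtain n where n: "composition J I n" using composition_exists[OF J I JI] by blast
  let ?V = "quotient_module R I J"
  interpret V: vectorspace "R Quot \<mm>" ?V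
    by (rule quotient_module_vectorspace[OF I J mI])
  obtain B where "B \<subseteq> carrier ?V" "finite B" "card B = n" "\<not> V.lin_dep B"
    "V.span B = (\<lambda>x. J +> x) ` I"
    using quotient_module_composition_basis[OF I J mI n] by blast
  moreover have "carrier ?V = (\<lambda>x. J +> x) ` I" by (simp add: quotient_module_def)
  ultimately have "V.dim = n" using V.dim_basis[of B] unfolding V.basis_def by auto
  then show ?thesis using rank_composition[OF n] by (simp add: residue_dim_def)
qed

section \<open>The length of the ring as a module over itself\<close>

lemma submodule_regular_module_iff:
  "LinearCombinations.submodule R N (regular_module R) \<longleftrightarrow> ideal N R"
proof
  assume N: "LinearCombinations.submodule R N (regular_module R)"
  then have sub: "N \<subseteq> carrier R" and add: "\<And>u v. u \<in> N \<Longrightarrow> v \<in> N \<Longrightarrow> u \<oplus> v \<in> N"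
    and zero: "\<zero> \<in> N" and mult: "\<And>a v. a \<in> carrier R \<Longrightarrow> v \<in> N \<Longrightarrow> a \<otimes> v \<in> N"
    by (auto simp: LinearCombinations.submodule_def regular_module_def)
  show "ideal N R"
  proof (rule idealI)
    show "ring R" by (rule ring_axioms)
    show "subgroup N (add_monoid R)"
    proof (rule add.subgroupI)
      fix a assume a: "a \<in> N"
      then have "\<ominus> \<one> \<otimes> a \<in> N" by (intro mult) auto
      then show "\<ominus> a \<in> N" using a sub by (auto simp: l_minus)
    qed (use sub zero add in auto)
    fix a x assume "a \<in> N" "x \<in> carrier R"
    then show "x \<otimes> a \<in> N" "a \<otimes> x \<in> N" using mult[of x a] sub m_comm[of a x] by auto
  qed
next
  assume "ideal N R"
  then interpret N: ideal N R .
  show "LinearCombinations.submodule R N (regular_module R)"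
    unfolding LinearCombinations.submodule_def
    using regular_module_module N.Icarr N.a_closed N.zero_closed N.I_l_closed
    by (auto simp: regular_module_def)
qed

lemma composition_chain:
  "composition J I n \<Longrightarrow> \<exists>N. N 0 = J \<and> N n = I \<and> (\<forall>i<n. cover (N i) (N (Suc i)))"
proof (induction rule: composition.induct)
  case refl
  then show ?case by auto
next
  case (step K n I)
  then obtain N where "N 0 = J" "N n = K" "\<forall>i<n. cover (N i) (N (Suc i))" by blast
  with step.hyps show ?case by (intro exI[of _ "N(Suc n := I)"]) (auto simp: less_Suc_eq)
qed

text \<open>Along a strict chain of ideals \<open>rank\<close> grows at every step, so no chain is
  longer than \<open>rank (carrier R)\<close>; a composition series from zero to \<open>R\<close>
  attains this length.\<close>

lemma module_length_regular_module:
  "module_length R (regular_module R) = enat (rank (carrier R))"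
proof (rule antisym)
  show "module_length R (regular_module R) \<le> enat (rank (carrier R))"
    unfolding module_length_def
  proof (rule Sup_least, clarify)
    fix n N
    assume N: "\<forall>i\<le>n. LinearCombinations.submodule R (N i) (regular_module R)"
      "\<forall>i<n. N i \<subset> N (Suc i)"
    have id: "ideal (N i) R" if "i \<le> n" for i using N that submodule_regular_module_iff by blast
    have "i \<le> rank (N i)" if "i \<le> n" for i
      using that
    proof (induction i)
      case (Suc i)
      have "rank (N i) < rank (N (Suc i))" using Suc.prems N(2) by (intro rank_less id) auto
      then show ?case using Suc by simp
    qed simp
    moreover have "rank (N n) \<le> rank (carrier R)"
      using id[of n] by (intro rank_mono oneideal) (auto dest: ideal.Icarr)
    ultimately show "enat n \<le> enat (rank (carrier R))" by (metis enat_ord_simps(1) le_refl le_trans)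
  qed
  obtain N where N: "N 0 = {\<zero>}" "N (rank (carrier R)) = carrier R"
    "\<forall>i<rank (carrier R). cover (N i) (N (Suc i))"
    using composition_chain[OF composition_rank[OF oneideal]] by blast
  have "ideal (N i) R" if "i \<le> rank (carrier R)" for i
    using that N(1,3) zeroideal by (cases i) (auto simp: Suc_le_eq intro: coverD(2))
  then show "enat (rank (carrier R)) \<le> module_length R (regular_module R)"
    unfolding module_length_def submodule_regular_module_iff using N(3) coverD(3)
    by (intro Sup_upper CollectI exI[of _ "rank (carrier R)"] exI[of _ N]) simp
qed

end

section \<open>Numbers of generators\<close>

text \<open>Pascal's rule in the shape of the induction in \<open>few_generators\<close>: one
  summand for dropping a generator of \<mm>, one for lowering the degree.\<close>

lemma shifted_binomial_rec:
  "shifted_binomial (Suc e) (Suc i) = shifted_binomial e (Suc i) + shifted_binomial (Suc e) i"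
  by (simp add: shifted_binomial_def add.commute)

lemma shifted_binomial_zero [simp]: "shifted_binomial e 0 = 1"
  by (simp add: shifted_binomial_def)

lemma shifted_binomial_pos: "e \<noteq> 0 \<or> i = 0 \<Longrightarrow> 0 < shifted_binomial e i"
  by (cases e) (auto simp: shifted_binomial_def)

lemma shifted_binomial_mono:
  assumes "e \<noteq> 0" "i \<le> j" shows "shifted_binomial e i \<le> shifted_binomial e j"
proof -
  obtain d where "e = Suc d" using assms(1) by (cases e) auto
  then have "shifted_binomial e i \<le> shifted_binomial e (Suc i)" for i
    by (simp add: shifted_binomial_rec)
  then show ?thesis using assms(2) by (rule lift_Suc_mono_le)
qed

definition (in ring) colon :: "'a set \<Rightarrow> 'a set \<Rightarrow> 'a set" where
  "colon I K = {a \<in> carrier R. \<forall>x\<in>K. a \<otimes> x \<in> I}"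

lemma (in cring) colon_ideal:
  assumes "ideal I R" "K \<subseteq> carrier R"
  shows "ideal (colon I K) R"
proof -
  interpret I: ideal I R by fact
  show ?thesis
  proof (rule idealI)
    show "ring R" by (rule ring_axioms)
    show "subgroup (colon I K) (add_monoid R)"
    proof (rule add.subgroupI)
      show "colon I K \<noteq> {}" using assms(2) by (auto simp: colon_def intro!: exI[of _ \<zero>])
    qed (use assms(2) in \<open>auto simp: colon_def l_distr l_minus subset_eq\<close>)
    fix a x assume a: "a \<in> colon I K" and x: "x \<in> carrier R"
    have "x \<otimes> a \<otimes> y \<in> I" if "y \<in> K" for y
      using that a x assms(2) I.I_l_closed[of "a \<otimes> y" x]
      by (simp add: colon_def m_assoc subset_eq)
    then show "x \<otimes> a \<in> colon I K" using a x by (simp add: colon_def)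
    then show "a \<otimes> x \<in> colon I K" using a x m_comm[of a x] by (simp add: colon_def)
  qed
qed

section \<open>Powers of the maximal ideal and generators modulo them\<close>

context local_ring
begin

lemma ideals_set_simps [simp]:
  "carrier (ideals_set R) = {I. ideal I R}" "\<one>\<^bsub>ideals_set R\<^esub> = carrier R"
  "I \<otimes>\<^bsub>ideals_set R\<^esub> J = I \<cdot> J"
  by (simp_all add: ideals_set_def)

lemma ideal_power_zero: "ideal_power R \<mm> 0 = carrier R"
  by simp

lemma ideal_power_ideal: "ideal (ideal_power R \<mm> n) R"
  by (induction n) (simp_all add: oneideal ideal_prod_is_ideal m.is_ideal)

lemma ideal_power_Suc_subset: "ideal_power R \<mm> (Suc n) \<subseteq> ideal_power R \<mm> n"
  using ideal_prod_inter[OF ideal_power_ideal m.is_ideal] by simp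

lemma ideal_power_antimono: "i \<le> j \<Longrightarrow> ideal_power R \<mm> j \<subseteq> ideal_power R \<mm> i"
  using ideal_power_Suc_subset by (rule lift_Suc_antimono_le)

lemma ideal_power_one: "ideal_power R \<mm> (Suc 0) = \<mm>"
  using ideal_prod_one[OF m.is_ideal] ideal_prod_commute[OF m.is_ideal oneideal]
  by simp

lemma ideal_power_mult:
  assumes "x \<in> ideal_power R \<mm> i" "y \<in> ideal_power R \<mm> j"
  shows "x \<otimes> y \<in> ideal_power R \<mm> (i + j)"
proof -
  interpret S: comm_monoid "ideals_set R" by (rule ideals_set_is_comm_monoid)
  have "\<mm> \<in> carrier (ideals_set R)" by (simp add: m.is_ideal)
  then have "ideal_power R \<mm> (i + j) = ideal_power R \<mm> i \<cdot> ideal_power R \<mm> j"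
    using S.nat_pow_mult[of \<mm> i j] by simp
  then show ?thesis using assms ideal_prod.prod by simp
qed

lemma ideal_power_smult:
  "a \<in> \<mm> \<Longrightarrow> x \<in> ideal_power R \<mm> i \<Longrightarrow> a \<otimes> x \<in> ideal_power R \<mm> (Suc i)"
  using ideal_power_mult[of a "Suc 0" x i] unfolding ideal_power_one by (simp del: nat_pow_Suc)

lemma ideal_power_Suc_subsetI:
  assumes K: "ideal K R" and "\<And>a x. \<lbrakk>a \<in> \<mm>; x \<in> ideal_power R \<mm> i\<rbrakk> \<Longrightarrow> a \<otimes> x \<in> K"
  shows "ideal_power R \<mm> (Suc i) \<subseteq> K"
proof
  interpret K: ideal K R by fact
  fix z assume "z \<in> ideal_power R \<mm> (Suc i)"
  then have "z \<in> ideal_power R \<mm> i \<cdot> \<mm>" by simp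
  then show "z \<in> K"
  proof (induction rule: ideal_prod.induct)
    case (prod x a)
    then show ?case
      using assms(2)[of a x] m_comm[of x a] m.Icarr[of a] ideal.Icarr[OF ideal_power_ideal, of x i]
      by simp
  qed (rule K.a_closed)
qed

text \<open>
  Generators of \<open>A\<close> modulo \<open>J + \<mm>\<^sup>j\<^sup>+\<^sup>1\<close> are obtained from those of its image modulo an
  element \<open>x\<close> of \<open>xs\<close> and from \<open>x\<close> times those of \<open>A : x\<close> modulo \<open>\<mm>\<^sup>j\<close>. That \<open>G\<close> generates \<open>A\<close>
  modulo an ideal is expressed by the ideals \<open>I\<close> containing both. The last hypothesis excludes
  \<open>A = R\<close> when the binomial coefficient vanishes.
\<close>

lemma few_generators:
  assumes "ideal A R" "ideal J R" "set xs \<subseteq> \<mm>"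
    and "\<And>I. \<lbrakk>ideal I R; J \<subseteq> I; set xs \<subseteq> I\<rbrakk> \<Longrightarrow> \<mm> \<subseteq> I"
    and "A \<noteq> carrier R \<or> xs \<noteq> [] \<or> j = 0"
  shows "\<exists>G\<subseteq>A. finite G \<and> card G \<le> shifted_binomial (length xs) j \<and>
    (\<forall>I. ideal I R \<longrightarrow> G \<subseteq> I \<longrightarrow> J \<subseteq> I \<longrightarrow> ideal_power R \<mm> (Suc j) \<subseteq> I \<longrightarrow> A \<subseteq> I)"
  using assms
proof (induction xs arbitrary: A J j)
  case Nil
  show ?case
  proof (cases "A = carrier R")
    case True
    with Nil have "j = 0" by simp
    then show ?thesis using True ideal.one_imp_carrier
      by (intro exI[of _ "{\<one>}"]) auto
  next
    case False
    then have "A \<subseteq> \<mm>" using proper_ideal_subset_maximal Nil.prems(1) by blast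
    moreover have "\<mm> \<subseteq> J" using Nil.prems(4)[OF Nil.prems(2)] by simp
    ultimately show ?thesis by (intro exI[of _ "{}"]) auto
  qed
next
  case (Cons x xs)
  note J = Cons.prems(2)
  have x: "x \<in> \<mm>" "x \<in> carrier R" using Cons.prems(3) m.Icarr by auto
  have P: "ideal (PIdl x) R" "x \<in> PIdl x" using x cgenideal_ideal cgenideal_self by auto
  \<comment> \<open>An inner induction on \<open>j\<close> with the list \<open>x # xs\<close>
    fixed: the outer hypothesis serves the shorter list in the same degree, the inner one the same
    list in the next lower degree.\<close>
  show ?case using Cons.prems(1,5)
  proof (induction j arbitrary: A)
    case 0
    show ?case
    proof (cases "A = carrier R")
      case True
      then show ?thesis using ideal.one_imp_carrier
        by (intro exI[of _ "{\<one>}"]) auto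
    next
      case False
      then have "A \<subseteq> \<mm>" using proper_ideal_subset_maximal 0 by blast
      then show ?thesis unfolding ideal_power_one by (intro exI[of _ "{}"]) auto
    qed
  next
    case (Suc j A)
    show ?case
    proof (cases "A = carrier R")
      case True
      have "0 < shifted_binomial (length (x # xs)) (Suc j)"
        by (rule shifted_binomial_pos) simp
      then show ?thesis using True ideal.one_imp_carrier
        by (intro exI[of _ "{\<one>}"]) auto
    next
      case False
      let ?p = "ideal_power R \<mm>"
      let ?J2 = "J <+> PIdl x"
      interpret A: ideal A R by (rule Suc.prems)
      have J2: "ideal ?J2 R" "J \<subseteq> ?J2" "x \<in> ?J2"
        using J P subset_ideal_sum[OF J P(1)] add_ideals by auto
      have "\<mm> \<subseteq> I" if "ideal I R" "?J2 \<subseteq> I" "set xs \<subseteq> I" for I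
        using that J2 by (intro Cons.prems(4)) auto
      then obtain G1 where G1: "G1 \<subseteq> A" "finite G1"
        "card G1 \<le> shifted_binomial (length xs) (Suc j)"
        "\<And>I. \<lbrakk>ideal I R; G1 \<subseteq> I; ?J2 \<subseteq> I; ?p (Suc (Suc j)) \<subseteq> I\<rbrakk> \<Longrightarrow> A \<subseteq> I"
        using Cons.IH[OF Suc.prems(1) J2(1), of "Suc j"] Cons.prems(3) False by auto
      let ?T = "J <+> ?p (Suc (Suc j))"
      \<comment> \<open>The colon ideal is formed from \<open>?A2\<close> instead of
        \<open>A\<close>: the element \<open>u\<close> below may involve \<open>J\<close> and
        \<mm>^(j+2), so that \<open>b \<otimes> x = z \<ominus> u\<close> is only known to lie in
        \<open>?A2\<close>.\<close>
      let ?A2 = "A <+> ?T"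
      have T: "ideal ?T R" "J \<subseteq> ?T" "?p (Suc (Suc j)) \<subseteq> ?T"
        using add_ideals[OF J ideal_power_ideal] subset_ideal_sum[OF J ideal_power_ideal]
        by blast+
      have A2: "ideal ?A2 R" "A \<subseteq> ?A2" "?T \<subseteq> ?A2"
        using T subset_ideal_sum[OF Suc.prems(1) T(1)] add_ideals Suc.prems(1) by auto
      have "ideal (colon ?A2 {x}) R" using colon_ideal A2(1) x by simp
      then obtain G' where G': "G' \<subseteq> colon ?A2 {x}" "finite G'"
        "card G' \<le> shifted_binomial (length (x # xs)) j"
        "\<And>I. \<lbrakk>ideal I R; G' \<subseteq> I; J \<subseteq> I; ?p (Suc j) \<subseteq> I\<rbrakk> \<Longrightarrow> colon ?A2 {x} \<subseteq> I"
        using Suc.IH by blast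
      \<comment> \<open>The generators must lie in \<open>A\<close> itself. Each
        \<open>g \<otimes> x\<close> differs from an element \<open>h g\<close> of \<open>A\<close>
        by an element of \<open>?T\<close>, which is contained in every ideal \<open>I\<close> to be
        tested.\<close>
      have "\<forall>g\<in>G'. \<exists>a. a \<in> A \<and> (\<exists>t\<in>?T. g \<otimes> x = a \<oplus> t)"
        using G'(1) unfolding colon_def set_add_def'[of R A] by blast
      then obtain h where h: "\<And>g. g \<in> G' \<Longrightarrow> h g \<in> A \<and> (\<exists>t\<in>?T. g \<otimes> x = h g \<oplus> t)"
        by metis
      let ?G = "G1 \<union> h ` G'"
      have "card ?G \<le> card G1 + card G'"
        using card_Un_le[of G1 "h ` G'"] card_image_le[OF G'(2), of h] by linarith
      then have "card ?G \<le> shifted_binomial (length (x # xs)) (Suc j)"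
        using G1(3) G'(3) by (simp add: shifted_binomial_rec)
      moreover have "A \<subseteq> I" if I: "ideal I R" and GI: "?G \<subseteq> I" and JI: "J \<subseteq> I"
        and pI: "?p (Suc (Suc j)) \<subseteq> I" for I
      proof
        interpret I: ideal I R by fact
        fix z assume z: "z \<in> A"
        \<comment> \<open>Testing \<open>G1\<close> with \<open>?K <+> PIdl x\<close> instead of
          \<open>I <+> PIdl x\<close> puts \<open>u\<close> into both \<open>I\<close> and
          \<open>?A2\<close>.\<close>
        let ?K = "I \<inter> ?A2"
        have K: "ideal ?K R" using i_intersect[OF I A2(1)] .
        have KP: "ideal (?K <+> PIdl x) R" "?K \<subseteq> ?K <+> PIdl x" "PIdl x \<subseteq> ?K <+> PIdl x"
          using subset_ideal_sum[OF K P(1)] add_ideals[OF K P(1)] by blast+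
        have "G1 \<subseteq> I" using GI by blast
        then have G1K: "G1 \<subseteq> ?K" using subset_trans[OF G1(1) A2(2)] by (rule Int_greatest)
        have JK: "J \<subseteq> ?K" using JI subset_trans[OF T(2) A2(3)] by (rule Int_greatest)
        have pK: "?p (Suc (Suc j)) \<subseteq> ?K"
          using pI subset_trans[OF T(3) A2(3)] by (rule Int_greatest)
        note K2 = G1K[THEN subset_trans, OF KP(2)] JK[THEN subset_trans, OF KP(2)]
          pK[THEN subset_trans, OF KP(2)]
        have "A \<subseteq> ?K <+> PIdl x"
          by (rule G1(4)[OF KP(1) K2(1) ideal_sum_subset[OF KP(1) K2(2) KP(3)] K2(3)])
        then obtain u b where ub: "u \<in> ?K" "b \<in> carrier R" "z = u \<oplus> b \<otimes> x"
          using subsetD[OF _ z] mem_ideal_sum_cgenideal[THEN iffD1, of z ?K x] by blast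
        have "u \<in> carrier R" using I.Icarr ub(1) by blast
        then have "b \<otimes> x = z \<ominus> u"
          using ub(2,3) x(2) a_comm[of u "b \<otimes> x"] by (simp add: a_minus_def a_assoc r_neg)
        also have "z \<ominus> u \<in> ?A2"
          using ideal_minus_closed[OF A2(1)] z ub(1) A2(2) by blast
        finally have b: "b \<in> colon ?A2 {x}" using ub(2) by (simp add: colon_def)
        have "ideal (colon I {x}) R" using colon_ideal I x by simp
        moreover have "G' \<subseteq> colon I {x}"
        proof
          fix g assume g: "g \<in> G'"
          then obtain t where "t \<in> ?T" "g \<otimes> x = h g \<oplus> t" using h by blast
          moreover have "?T \<subseteq> I" using I JI pI by (rule ideal_sum_subset)
          moreover have "h g \<in> I" using GI g by blast
          ultimately have "g \<otimes> x \<in> I" using I.a_closed by auto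
          then show "g \<in> colon I {x}" using g G'(1) by (auto simp: colon_def)
        qed
        moreover have "J \<subseteq> colon I {x}"
          using JI I.I_r_closed x I.Icarr by (auto simp: colon_def)
        moreover have "?p (Suc j) \<subseteq> colon I {x}"
        proof
          fix y assume y: "y \<in> ?p (Suc j)"
          then have yc: "y \<in> carrier R" using ideal.Icarr[OF ideal_power_ideal] by blast
          have "x \<otimes> y \<in> I" using ideal_power_smult[OF x(1) y] pI by blast
          then show "y \<in> colon I {x}" using x yc by (simp add: colon_def m_comm)
        qed
        ultimately have "colon ?A2 {x} \<subseteq> colon I {x}" by (rule G'(4))
        then have "b \<otimes> x \<in> I" using b by (auto simp: colon_def)
        then show "z \<in> I" unfolding ub(3) using ub(1) by (intro I.a_closed) auto
      qed
      moreover have "?G \<subseteq> A" "finite ?G" using G1(1,2) G'(2) h by auto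
      ultimately show ?thesis by (intro exI[of _ ?G]) blast
    qed
  qed
qed

end

section \<open>From numbers of generators to bounds on lengths\<close>

context local_artinian_ring
begin

text \<open>Every element of \<open>G\<close> is killed by \<mm> modulo \<open>B\<close>, so
  adjoining it to an ideal above \<open>B\<close> either changes nothing or is a simple
  step.\<close>

lemma rank_adjoin_le:
  assumes B: "ideal B R" and "finite G" "G \<subseteq> carrier R"
    and mG: "\<And>a g. \<lbrakk>a \<in> \<mm>; g \<in> G\<rbrakk> \<Longrightarrow> a \<otimes> g \<in> B"
  shows "\<exists>I. ideal I R \<and> B \<subseteq> I \<and> G \<subseteq> I \<and> rank I \<le> rank B + card G"
  using assms(2-4)
proof (induction rule: finite_induct)
  case empty
  then show ?case using B by auto
next
  case (insert g G)
  then obtain I where I: "ideal I R" "B \<subseteq> I" "G \<subseteq> I" "rank I \<le> rank B + card G" by auto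
  show ?case
  proof (cases "g \<in> I")
    case True
    then show ?thesis using I insert by (intro exI[of _ I]) auto
  next
    case False
    have g: "g \<in> carrier R" using insert by blast
    have "cover I (I <+> PIdl g)"
      using I(1,2) g False insert.prems(2) by (intro cover_adjoin) auto
    then have "rank (I <+> PIdl g) = Suc (rank I)" "ideal (I <+> PIdl g) R"
      using rank_cover coverD(2) by simp_all
    moreover have "I \<subseteq> I <+> PIdl g" "g \<in> I <+> PIdl g"
      using subset_ideal_sum[OF I(1) cgenideal_ideal[OF g]] cgenideal_self[OF g] by blast+
    moreover have "rank B + card (insert g G) = Suc (rank B + card G)" using insert by simp
    ultimately show ?thesis using I(2-4) by (intro exI[of _ "I <+> PIdl g"]) auto
  qed
qed

lemma coatom_exists:
  assumes J: "ideal J R" and I: "ideal I R" and JI: "J \<subset> I"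
  shows "\<exists>K. cover K I \<and> J \<subseteq> K"
proof -
  obtain n where "composition J I n" using composition_exists[OF J I] JI by blast
  then show ?thesis
  proof (cases rule: composition.cases)
    case refl
    then show ?thesis using JI by blast
  next
    case (step K n)
    then show ?thesis using composition_subset[of J K n] by blast
  qed
qed

lemma composition_generators:
  "composition J K n \<Longrightarrow> \<exists>xs. length xs = n \<and> set xs \<subseteq> K \<and>
    (\<forall>I. ideal I R \<longrightarrow> J \<subseteq> I \<longrightarrow> set xs \<subseteq> I \<longrightarrow> K \<subseteq> I)"
proof (induction rule: composition.induct)
  case refl
  then show ?case by simp
next
  case (step K n K')
  then obtain xs where xs: "length xs = n" "set xs \<subseteq> K"
    "\<And>I. \<lbrakk>ideal I R; J \<subseteq> I; set xs \<subseteq> I\<rbrakk> \<Longrightarrow> K \<subseteq> I" by blast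
  obtain x where x: "x \<in> K'" "x \<notin> K" using coverD(3)[OF step.hyps(2)] by blast
  have "K' \<subseteq> I" if "ideal I R" "J \<subseteq> I" "set (x # xs) \<subseteq> I" for I
    using cover_between[OF step.hyps(2) that(1) xs(3)[OF that(1,2)] _ x] that(3) by simp
  then show ?case using xs(1,2) x(1) coverD(3)[OF step.hyps(2)]
    by (intro exI[of _ "x # xs"]) auto
qed

text \<open>Nakayama's lemma for \<open>\<mm>\<close>: an ideal properly below \<open>\<mm>\<close> lies in a coatom of \<open>\<mm>\<close>, and
  the latter contains \<open>\<mm>\<^sup>2\<close>.\<close>

lemma maximal_ideal_generators:
  "\<exists>xs. length xs = embedding_dim R \<mm> \<and> set xs \<subseteq> \<mm> \<and>
    (\<forall>I. ideal I R \<longrightarrow> set xs \<subseteq> I \<longrightarrow> \<mm> \<subseteq> I)"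
proof -
  let ?p = "ideal_power R \<mm> (Suc (Suc 0))"
  have p: "?p \<subseteq> \<mm>" using ideal_power_Suc_subset[of "Suc 0"] unfolding ideal_power_one .
  have mp: "a \<otimes> x \<in> ?p" if "a \<in> \<mm>" "x \<in> \<mm>" for a x
    using ideal_power_smult[of a x "Suc 0"] that unfolding ideal_power_one by blast
  obtain n where n: "composition ?p \<mm> n"
    using composition_exists[OF ideal_power_ideal m.is_ideal p] by blast
  have "n = embedding_dim R \<mm>"
    using rank_composition[OF n] residue_dim_rank[OF m.is_ideal ideal_power_ideal p mp]
    by (simp add: embedding_dim_def numeral_2_eq_2)
  moreover obtain xs where xs: "length xs = n" "set xs \<subseteq> \<mm>"
    "\<And>I. \<lbrakk>ideal I R; ?p \<subseteq> I; set xs \<subseteq> I\<rbrakk> \<Longrightarrow> \<mm> \<subseteq> I"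
    using composition_generators[OF n] by blast
  moreover have "\<mm> \<subseteq> I" if I: "ideal I R" "set xs \<subseteq> I" for I
  proof (rule ccontr)
    assume "\<not> \<mm> \<subseteq> I"
    then have "I \<inter> \<mm> \<subset> \<mm>" by blast
    then obtain K where K: "cover K \<mm>" "I \<inter> \<mm> \<subseteq> K"
      using coatom_exists[OF i_intersect[OF I(1) m.is_ideal] m.is_ideal] by blast
    have "?p \<subseteq> K"
      by (rule ideal_power_Suc_subsetI[OF coverD(1)[OF K(1)]])
        (use coverD(4)[OF K(1)] in \<open>simp only: ideal_power_one\<close>)
    moreover have "set xs \<subseteq> K" using xs(2) I(2) K(2) by blast
    ultimately show False using xs(3) coverD(1,3)[OF K(1)] by blast
  qed
  ultimately show ?thesis by blast
qed

text \<open>Since \<mm>^(j+1) lies in \<open>B\<close>, the generators of \<open>A\<close> modulo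
  \<mm>^(j+1) from \<open>few_generators\<close>, taken with \<open>J = {\<zero>}\<close>, generate
  \<open>A\<close> modulo \<open>B\<close>. As \<mm> kills \<open>A\<close> modulo \<open>B\<close>,
  each of them adds at most one to the length.\<close>

lemma rank_le_shifted_binomial:
  assumes A: "ideal A R" and B: "ideal B R"
    and mA: "\<And>a x. \<lbrakk>a \<in> \<mm>; x \<in> A\<rbrakk> \<Longrightarrow> a \<otimes> x \<in> B"
    and pB: "ideal_power R \<mm> (Suc j) \<subseteq> B"
    and nz: "A \<noteq> carrier R \<or> embedding_dim R \<mm> \<noteq> 0 \<or> j = 0"
  shows "rank A \<le> rank B + shifted_binomial (embedding_dim R \<mm>) j"
proof -
  obtain xs where xs: "length xs = embedding_dim R \<mm>" "set xs \<subseteq> \<mm>"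
    "\<And>I. \<lbrakk>ideal I R; set xs \<subseteq> I\<rbrakk> \<Longrightarrow> \<mm> \<subseteq> I"
    using maximal_ideal_generators by blast
  have "\<exists>G\<subseteq>A. finite G \<and> card G \<le> shifted_binomial (length xs) j \<and>
    (\<forall>I. ideal I R \<longrightarrow> G \<subseteq> I \<longrightarrow> {\<zero>} \<subseteq> I \<longrightarrow> ideal_power R \<mm> (Suc j) \<subseteq> I \<longrightarrow> A \<subseteq> I)"
    by (rule few_generators) (use A zeroideal xs nz in auto)
  then obtain G where G: "G \<subseteq> A" "finite G" "card G \<le> shifted_binomial (length xs) j"
    "\<And>I. \<lbrakk>ideal I R; G \<subseteq> I; {\<zero>} \<subseteq> I; ideal_power R \<mm> (Suc j) \<subseteq> I\<rbrakk> \<Longrightarrow> A \<subseteq> I"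
    by (elim exE conjE) simp
  have "G \<subseteq> carrier R" using G(1) ideal.Icarr[OF A] by blast
  then obtain I where I: "ideal I R" "B \<subseteq> I" "G \<subseteq> I" "rank I \<le> rank B + card G"
    using rank_adjoin_le[OF B G(2), OF _ mA] G(1) by blast
  then have "A \<subseteq> I" using pB zero_subset_ideal by (intro G(4)) auto
  then show ?thesis using rank_mono[OF A I(1)] I(4) G(3) xs(1) by simp
qed

section \<open>The top socle degree and the Hilbert function\<close>

text \<open>A coatom of a nonzero \<mm>^n contains \<mm>^(n+1), so the powers drop strictly until
  they vanish. This bounds the exponents of nonzero powers, which makes the \<open>GREATEST\<close>
  in \<open>top_socle_degree\<close> meaningful.\<close>

lemma rank_ideal_power_bound:
  "ideal_power R \<mm> n \<noteq> {\<zero>} \<Longrightarrow> rank (ideal_power R \<mm> n) + n \<le> rank (carrier R)"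
proof (induction n)
  case 0
  then show ?case by simp
next
  case (Suc n)
  let ?p = "ideal_power R \<mm>"
  have "{\<zero>} \<subset> ?p n"
    using Suc.prems ideal_power_Suc_subset[of n] zero_subset_ideal[OF ideal_power_ideal] by blast
  then obtain K where K: "cover K (?p n)"
    using coatom_exists[OF zeroideal ideal_power_ideal] by blast
  have "?p (Suc n) \<subseteq> K"
    using coverD(1,4)[OF K] by (rule ideal_power_Suc_subsetI)
  then have "rank (?p (Suc n)) < rank (?p n)"
    using rank_mono[OF ideal_power_ideal coverD(1)[OF K]] rank_cover[OF K] by fastforce
  moreover have "?p n \<noteq> {\<zero>}" using \<open>{\<zero>} \<subset> ?p n\<close> by blast
  ultimately show ?case using Suc.IH by linarith
qed

lemma
  shows ideal_power_top_socle_degree: "ideal_power R \<mm> (top_socle_degree R \<mm>) \<noteq> {\<zero>}"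
    and ideal_power_above_top_socle_degree:
      "top_socle_degree R \<mm> < n \<Longrightarrow> ideal_power R \<mm> n = {\<zero>}"
proof -
  let ?P = "\<lambda>n. ideal_power R \<mm> n \<noteq> {\<zero>}"
  have "carrier R \<noteq> {\<zero>}"
    using m.I_notcarr zero_subset_ideal[OF m.is_ideal] m.a_subset by blast
  then have P0: "?P 0" unfolding ideal_power_zero .
  have bd: "\<And>n. ?P n \<Longrightarrow> n \<le> rank (carrier R)" using rank_ideal_power_bound by fastforce
  show "?P (top_socle_degree R \<mm>)"
    unfolding top_socle_degree_def by (rule GreatestI_nat[of ?P, OF P0 bd])
  show "ideal_power R \<mm> n = {\<zero>}" if "top_socle_degree R \<mm> < n"
    using that Greatest_le_nat[of ?P n, OF _ bd] unfolding top_socle_degree_def by fastforce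
qed

lemma rank_hilbert_fun:
  "rank (ideal_power R \<mm> i) = rank (ideal_power R \<mm> (Suc i)) + hilbert_fun R \<mm> i"
  using residue_dim_rank[OF ideal_power_ideal ideal_power_ideal ideal_power_Suc_subset ideal_power_smult]
  by (simp add: hilbert_fun_def)

lemma rank_carrier_eq_sum_hilbert_fun:
  "rank (carrier R) = (\<Sum>i=0..top_socle_degree R \<mm>. hilbert_fun R \<mm> i)"
proof -
  have "rank (carrier R) = rank (ideal_power R \<mm> (Suc n)) + (\<Sum>i=0..n. hilbert_fun R \<mm> i)" for n
  proof (induction n)
    case 0
    then show ?case using rank_hilbert_fun[of 0] unfolding ideal_power_zero by simp
  next
    case (Suc n)
    then show ?case using rank_hilbert_fun[of "Suc n"] by (simp del: nat_pow_Suc)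
  qed
  from this[of "top_socle_degree R \<mm>"] show ?thesis
    unfolding ideal_power_above_top_socle_degree[OF lessI] by simp
qed

text \<open>The generator bound for the pair \<mm>^(i+1) \<subseteq> \<mm>^i with
  \<open>j = i\<close>. Its nondegeneracy condition holds because \<mm>^i is proper unless
  \<open>i = 0\<close>.\<close>

lemma hilbert_fun_le_shifted_binomial:
  "hilbert_fun R \<mm> i \<le> shifted_binomial (embedding_dim R \<mm>) i"
proof -
  have "ideal_power R \<mm> i \<noteq> carrier R" if "i \<noteq> 0"
  proof -
    have "ideal_power R \<mm> i \<subseteq> \<mm>"
      using ideal_power_antimono[of "Suc 0" i] that unfolding ideal_power_one by simp
    then show ?thesis using m.I_notcarr m.a_subset by blast
  qed
  then have "rank (ideal_power R \<mm> i) \<le> rank (ideal_power R \<mm> (Suc i)) +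
      shifted_binomial (embedding_dim R \<mm>) i"
    using ideal_power_smult
    by (intro rank_le_shifted_binomial[OF ideal_power_ideal ideal_power_ideal]) auto
  then show ?thesis using rank_hilbert_fun[of i] by linarith
qed

section \<open>The socle and its filtration by powers of the maximal ideal\<close>

lemma socle_ideal: "ideal (socle R \<mm>) R"
proof -
  have "socle R \<mm> = colon {\<zero>} \<mm>"
    unfolding socle_def colon_def using m_comm m.Icarr by (intro Collect_cong) auto
  then show ?thesis using colon_ideal[OF zeroideal m.a_subset] by simp
qed

lemma socle_inter_ideal: "ideal I R \<Longrightarrow> ideal (socle R \<mm> \<inter> I) R"
  by (rule i_intersect[OF socle_ideal])

lemma rank_socle_coeff:
  "rank (socle R \<mm> \<inter> ideal_power R \<mm> i) =
    rank (socle R \<mm> \<inter> ideal_power R \<mm> (Suc i)) + socle_coeff R \<mm> i"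
proof -
  note id = socle_inter_ideal[OF ideal_power_ideal]
  have sub: "socle R \<mm> \<inter> ideal_power R \<mm> (Suc i) \<subseteq> socle R \<mm> \<inter> ideal_power R \<mm> i"
    using ideal_power_Suc_subset by blast
  have "a \<otimes> x \<in> socle R \<mm> \<inter> ideal_power R \<mm> (Suc i)"
    if "a \<in> \<mm>" "x \<in> socle R \<mm> \<inter> ideal_power R \<mm> i" for a x
  proof -
    have "a \<otimes> x = \<zero>" using that by (auto simp: socle_def)
    then show ?thesis using zero_subset_ideal[OF id[of "Suc i"]] by blast
  qed
  then show ?thesis using residue_dim_rank[OF id id sub]
    by (simp add: socle_coeff_def del: nat_pow_Suc)
qed

text \<open>A nonzero ideal contains a minimal nonzero ideal, and the latter is killed by
  \<mm>.\<close>

lemma socle_essential: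
  assumes I: "ideal I R" and "socle R \<mm> \<inter> I \<subseteq> {\<zero>}"
  shows "I = {\<zero>}"
proof (rule ccontr)
  assume "I \<noteq> {\<zero>}"
  then have "{\<zero>} \<subset> I" using zero_subset_ideal[OF I] by blast
  then obtain L where L: "cover {\<zero>} L" "L \<subseteq> I" using cover_exists[OF zeroideal I] by blast
  have "L \<subseteq> socle R \<mm>"
    unfolding socle_def using coverD(4)[OF L(1)] ideal.Icarr[OF coverD(2)[OF L(1)]] by blast
  then show False using assms(2) L(2) coverD(3)[OF L(1)] by blast
qed

section \<open>Irreducible ideals and the socle\<close>

text \<open>\<open>L/q\<close> is the simple socle of \<open>R/q\<close>. For \<open>x\<close> in
  \<open>K' - K\<close>, multiplication by \<open>x\<close> sends \<open>q : K\<close> into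
  \<open>L\<close>, and the elements sent into \<open>q\<close> are those of \<open>q : K'\<close>.
  So the quotient of these two colon ideals embeds in a simple module.\<close>

lemma rank_colon_cover:
  assumes q: "cover q L" and irr: "\<And>I. \<lbrakk>ideal I R; q \<subset> I\<rbrakk> \<Longrightarrow> L \<subseteq> I"
    and qK: "q \<subseteq> K" and KK': "cover K K'"
  shows "rank (colon q K) \<le> Suc (rank (colon q K'))"
proof -
  note c = coverD[OF KK'] and cq = coverD[OF q]
  interpret q: ideal q R by (rule cq(1))
  interpret K: ideal K R by (rule c(1))
  interpret K': ideal K' R by (rule c(2))
  have id: "ideal (colon q K) R" "ideal (colon q K') R"
    using colon_ideal[OF cq(1)] K.a_subset K'.a_subset by blast+
  have sub: "colon q K' \<subseteq> colon q K" using c(3) by (auto simp: colon_def)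
  show ?thesis
  proof (cases "colon q K = colon q K'")
    case False
    then obtain a where a: "a \<in> colon q K" "a \<notin> colon q K'" using sub by blast
    obtain x where x: "x \<in> K'" "x \<notin> K" using c(3) by blast
    have xc: "x \<in> carrier R" using K'.Icarr[OF x(1)] .
    have colonI: "b \<in> colon q K'" if b: "b \<in> colon q K" "b \<otimes> x \<in> q" for b
    proof -
      have bc: "b \<in> carrier R" using b by (simp add: colon_def)
      have "b \<otimes> y \<in> q" if y: "y \<in> K'" for y
      proof -
        obtain j r where jr: "j \<in> K" "r \<in> carrier R" "y = j \<oplus> r \<otimes> x"
          using c(5)[OF x y] by blast
        have "b \<otimes> y = b \<otimes> j \<oplus> r \<otimes> (b \<otimes> x)"
          unfolding jr(3) using bc xc jr(2) K.Icarr[OF jr(1)] by (simp add: r_distr m_lcomm)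
        moreover have "b \<otimes> j \<in> q" using b(1) jr(1) by (simp add: colon_def)
        moreover have "r \<otimes> (b \<otimes> x) \<in> q" using b(2) jr(2) by (rule q.I_l_closed)
        ultimately show ?thesis using q.a_closed by simp
      qed
      then show ?thesis using bc by (simp add: colon_def)
    qed
    \<comment> \<open>As \<mm> moves \<open>x\<close> into \<open>K\<close>, it kills
      \<open>z \<otimes> x\<close> modulo \<open>q\<close>. If \<open>z \<otimes> x\<close> is not
      in \<open>q\<close>, it therefore generates a simple ideal over \<open>q\<close>, which
      contains \<open>L\<close> by \<open>irr\<close> and hence equals \<open>L\<close>.\<close>
    have mult_x: "z \<otimes> x \<in> L" if z: "z \<in> colon q K" for z
    proof (cases "z \<otimes> x \<in> q")
      case True
      then show ?thesis using cq(3) by blast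
    next
      case False
      have zc: "z \<in> carrier R" "z \<otimes> x \<in> carrier R" using z xc by (auto simp: colon_def)
      have "b \<otimes> (z \<otimes> x) \<in> q" if b: "b \<in> \<mm>" for b
      proof -
        have "z \<otimes> (b \<otimes> x) \<in> q" using z c(4)[OF b x(1)] by (simp add: colon_def)
        then show ?thesis using zc xc m.Icarr[OF b] by (simp add: m_lcomm)
      qed
      then have C: "cover q (q <+> PIdl (z \<otimes> x))" by (rule cover_adjoin[OF cq(1) zc(2) False])
      have "L \<subseteq> q <+> PIdl (z \<otimes> x)" by (rule irr[OF coverD(2,3)[OF C]])
      moreover obtain y where "y \<in> L" "y \<notin> q" using cq(3) by blast
      ultimately have "q <+> PIdl (z \<otimes> x) \<subseteq> L"
        using cover_between[OF C cq(2)] cq(3) by blast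
      moreover have "z \<otimes> x \<in> q <+> PIdl (z \<otimes> x)"
        using subset_ideal_sum(2)[OF cq(1) cgenideal_ideal[OF zc(2)]] cgenideal_self[OF zc(2)] by blast
      ultimately show ?thesis by blast
    qed
    have ax: "a \<otimes> x \<notin> q" using colonI a by blast
    have ac: "a \<in> carrier R" using a by (simp add: colon_def)
    have "cover (colon q K') (colon q K)"
    proof (rule coverI[OF id(2,1) sub a])
      fix b assume b: "b \<in> \<mm>"
      have "a \<otimes> (b \<otimes> x) \<in> q" using a(1) c(4)[OF b x(1)] by (simp add: colon_def)
      then have "b \<otimes> a \<otimes> x \<in> q" using ac xc m.Icarr[OF b] by (simp add: m_ac)
      moreover have "b \<otimes> a \<in> colon q K" using ideal.I_l_closed[OF id(1) a(1)] m.Icarr[OF b] .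
      ultimately show "b \<otimes> a \<in> colon q K'" by (intro colonI)
    next
      fix z assume z: "z \<in> colon q K"
      then have zc: "z \<in> carrier R" by (simp add: colon_def)
      obtain j b where jb: "j \<in> q" "b \<in> carrier R" "z \<otimes> x = j \<oplus> b \<otimes> (a \<otimes> x)"
        using cq(5)[OF mult_x[OF a(1)] ax mult_x[OF z]] by blast
      have jc: "j \<in> carrier R" using q.Icarr[OF jb(1)] .
      have zba: "z \<ominus> b \<otimes> a \<in> colon q K"
        using ideal_minus_closed[OF id(1) z] ideal.I_l_closed[OF id(1) a(1) jb(2)] .
      have "(z \<ominus> b \<otimes> a) \<otimes> x = z \<otimes> x \<ominus> b \<otimes> (a \<otimes> x)"
        using zc jb(2) ac xc by (simp add: a_minus_def l_distr l_minus m_assoc)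
      also have "\<dots> = j"
        unfolding jb(3) using jc jb(2) ac xc by (simp add: a_minus_def a_assoc r_neg)
      finally have "z \<ominus> b \<otimes> a \<in> colon q K'" using zba jb(1) by (intro colonI) simp_all
      moreover have "z = (z \<ominus> b \<otimes> a) \<oplus> b \<otimes> a"
        using zc jb(2) ac by (simp add: a_minus_def a_assoc l_neg)
      ultimately show "\<exists>j\<in>colon q K'. \<exists>b\<in>carrier R. z = j \<oplus> b \<otimes> a" using jb(2) by blast
    qed
    then show ?thesis using rank_cover by simp
  qed simp
qed

text \<open>Duality in the Gorenstein ring \<open>R/q\<close>: along a composition series from \<open>q\<close> to \<open>R\<close> the rank
  of \<open>q : K\<close> drops by at most one in each step, and the total drop is the length of the series;
  hence it drops by exactly one in each step.\<close>

lemma rank_le_rank_colon: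
  assumes q: "cover q L" and irr: "\<And>I. \<lbrakk>ideal I R; q \<subset> I\<rbrakk> \<Longrightarrow> L \<subseteq> I"
    and X: "ideal X R" and Y: "ideal Y R" and qY: "q \<subseteq> Y" and qX: "q \<subseteq> X"
  shows "rank X + rank (colon q X) \<le> rank Y + rank (colon q Y)"
proof -
  have qi: "ideal q R" by (rule coverD(1)[OF q])
  \<comment> \<open>The sum \<open>rank (colon q K) + rank K\<close> does not decrease as
    \<open>K\<close> grows. Its values at \<open>q\<close> and at \<open>R\<close> coincide, because
    \<open>q : q = R\<close> and \<open>q : R = q\<close>, so it is constant.\<close>
  have *: "rank (colon q K) + rank K \<le> rank (colon q K') + rank K'"
    if K: "ideal K R" "ideal K' R" "q \<subseteq> K" "K \<subseteq> K'" for K K'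
  proof -
    obtain n where "composition K K' n" using composition_exists[OF K(1,2,4)] by blast
    moreover have "rank (colon q K) + rank K \<le> rank (colon q K') + rank K'"
      if "composition K K' n" for K' n
      using that
    proof (induction rule: composition.induct)
      case refl
      show ?case by simp
    next
      case (step K1 n K2)
      have "q \<subseteq> K1" using K(3) composition_subset[OF step.hyps(1)] by (rule subset_trans)
      then show ?case
        using rank_colon_cover[OF q irr _ step.hyps(2)] rank_cover[OF step.hyps(2)] step.IH
        by fastforce
    qed
    ultimately show ?thesis by blast
  qed
  have c1: "colon q q = carrier R"
    using ideal.I_l_closed[OF qi] by (auto simp: colon_def)
  have c2: "colon q (carrier R) = q"
  proof
    show "colon q (carrier R) \<subseteq> q"
      unfolding colon_def by (metis (no_types, lifting) mem_Collect_eq one_closed r_one subsetI)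
    show "q \<subseteq> colon q (carrier R)"
      using ideal.I_r_closed[OF qi] ideal.Icarr[OF qi] by (auto simp: colon_def)
  qed
  have "rank (colon q X) + rank X \<le> rank q + rank (carrier R)"
    using *[OF X oneideal qX] ideal.Icarr[OF X] c2 by auto
  also have "rank q + rank (carrier R) \<le> rank (colon q Y) + rank Y"
    using *[OF qi Y _ qY] c1 by auto
  finally show ?thesis by linarith
qed

text \<open>The generator bound applied to the dual pair
  \<open>colon q X \<subseteq> colon q Y\<close> and carried back by duality. Here \<open>mX\<close>
  says that \<mm> kills the dual quotient, and \<open>pX\<close> that \<mm>^(j+1) lies in
  \<open>colon q X\<close>.\<close>

lemma rank_le_shifted_binomial_dual:
  assumes q: "cover q L" and irr: "\<And>I. \<lbrakk>ideal I R; q \<subset> I\<rbrakk> \<Longrightarrow> L \<subseteq> I"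
    and X: "ideal X R" and Y: "ideal Y R" and qY: "q \<subseteq> Y" and YX: "Y \<subseteq> X"
    and mX: "\<And>a x. \<lbrakk>a \<in> \<mm>; x \<in> X\<rbrakk> \<Longrightarrow> a \<otimes> x \<in> Y"
    and pX: "\<And>a x. \<lbrakk>a \<in> ideal_power R \<mm> (Suc j); x \<in> X\<rbrakk> \<Longrightarrow> a \<otimes> x \<in> q"
    and nz: "embedding_dim R \<mm> \<noteq> 0 \<or> j = 0"
  shows "rank X \<le> rank Y + shifted_binomial (embedding_dim R \<mm>) j"
proof -
  have qi: "ideal q R" by (rule coverD(1)[OF q])
  have Xc: "X \<subseteq> carrier R" and Yc: "Y \<subseteq> carrier R"
    using ideal.Icarr[OF X] ideal.Icarr[OF Y] by blast+
  have id: "ideal (colon q X) R" "ideal (colon q Y) R" using colon_ideal[OF qi] Xc Yc by blast+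
  have "rank (colon q Y) \<le> rank (colon q X) + shifted_binomial (embedding_dim R \<mm>) j"
  proof (rule rank_le_shifted_binomial[OF id(2,1)])
    fix a b assume a: "a \<in> \<mm>" and b: "b \<in> colon q Y"
    have bc: "b \<in> carrier R" using b by (simp add: colon_def)
    have "a \<otimes> b \<otimes> x \<in> q" if x: "x \<in> X" for x
    proof -
      have "b \<otimes> (a \<otimes> x) \<in> q" using b mX[OF a x] by (simp add: colon_def)
      then show ?thesis using bc m.Icarr[OF a] subsetD[OF Xc x] by (simp add: m_ac)
    qed
    then show "a \<otimes> b \<in> colon q X" using bc m.Icarr[OF a] by (simp add: colon_def)
  next
    show "ideal_power R \<mm> (Suc j) \<subseteq> colon q X"
      unfolding colon_def using pX ideal.Icarr[OF ideal_power_ideal] by blast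
  qed (use nz in blast)
  moreover have "rank X + rank (colon q X) \<le> rank Y + rank (colon q Y)"
    using qY YX by (intro rank_le_rank_colon[OF q irr X Y]) auto
  ultimately show ?thesis by linarith
qed

text \<open>One step of the descent: \<open>I\<close> is cut down to \<open>I \<inter> q\<close>, where \<open>R/q\<close> is Gorenstein of socle
  degree at most \<open>l\<close>, and this removes the socle elements in \<open>T' - T\<close>.\<close>

lemma socle_cover_step:
  fixes i l :: nat
  defines "w \<equiv> (if i \<le> l then shifted_binomial (embedding_dim R \<mm>) (l - i) else 0)"
  assumes TT': "cover T T'" and T': "T' \<subseteq> socle R \<mm>"
    and Sl: "socle R \<mm> \<inter> ideal_power R \<mm> (Suc l) \<subseteq> T"
    and I: "ideal I R" "socle R \<mm> \<inter> I \<subseteq> T'"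
    and nz: "embedding_dim R \<mm> \<noteq> 0 \<or> l = 0"
  shows "\<exists>I'. ideal I' R \<and> socle R \<mm> \<inter> I' \<subseteq> T \<and>
    rank (ideal_power R \<mm> i \<inter> I) + rank (ideal_power R \<mm> (Suc i) \<inter> I') \<le>
    rank (ideal_power R \<mm> (Suc i) \<inter> I) + rank (ideal_power R \<mm> i \<inter> I') + w"
proof -
  let ?p = "ideal_power R \<mm>"
  note c = coverD[OF TT']
  interpret T: ideal T R by (rule c(1))
  interpret T': ideal T' R by (rule c(2))
  interpret p: ideal "?p (Suc l)" R by (rule ideal_power_ideal)
  obtain \<sigma> where \<sigma>: "\<sigma> \<in> T'" "\<sigma> \<notin> T" using c(3) by blast
  \<comment> \<open>If \<open>\<sigma> = t \<oplus> y\<close>, then \<open>y\<close> lies in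
    \<open>T'\<close>, hence in the socle, and in \<mm>^(l+1), so \<open>Sl\<close> puts it into
    \<open>T\<close>, and \<open>\<sigma>\<close> with it.\<close>
  have \<sigma>p: "\<sigma> \<notin> T <+> ?p (Suc l)"
  proof
    assume "\<sigma> \<in> T <+> ?p (Suc l)"
    then obtain t y where ty: "t \<in> T" "y \<in> ?p (Suc l)" "\<sigma> = t \<oplus> y"
      unfolding set_add_def' by blast
    have tT': "t \<in> T'" using ty(1) c(3) by blast
    have "y = \<sigma> \<ominus> t"
      using ty(3) p.Icarr[OF ty(2)] T.Icarr[OF ty(1)] a_comm[of t y]
      by (simp add: a_minus_def a_assoc r_neg)
    then have "y \<in> T'" using ideal_minus_closed[OF c(2) \<sigma>(1) tT'] by simp
    then have "y \<in> T" using T' Sl ty(2) by blast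
    then show False using \<sigma>(2) ty(1,3) T.a_closed by simp
  qed
  \<comment> \<open>A maximal member \<open>q\<close> of this family is irreducible, since every
    larger ideal contains \<open>\<sigma>\<close>; \<mm>^(l+1) \<subseteq> q bounds the socle degree
    of \<open>R/q\<close> by \<open>l\<close>.\<close>
  let ?A = "{J. ideal J R \<and> T <+> ?p (Suc l) \<subseteq> J \<and> \<sigma> \<notin> J}"
  have "T <+> ?p (Suc l) \<in> ?A" using \<sigma>p add_ideals[OF c(1) ideal_power_ideal] by blast
  then obtain q where q: "q \<in> ?A" and max: "\<And>J. J \<in> ?A \<Longrightarrow> q \<subseteq> J \<Longrightarrow> J = q"
    using maximal_element_exists[of ?A] by (metis (no_types, lifting) empty_iff mem_Collect_eq)
  have qi: "ideal q R" and \<sigma>q: "\<sigma> \<notin> q" using q by auto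
  have Tq: "T \<subseteq> q" and pq: "?p (Suc l) \<subseteq> q"
    using q subset_ideal_sum[OF c(1) ideal_power_ideal] by blast+
  interpret q: ideal q R by (rule qi)
  have \<sigma>_above: "\<sigma> \<in> J" if J: "ideal J R" "q \<subset> J" for J
  proof (rule ccontr)
    assume "\<sigma> \<notin> J"
    then have "J \<in> ?A" using J q by blast
    then show False using max[of J] J(2) by blast
  qed
  have "q \<subset> carrier R" using q.a_subset \<sigma>q T'.Icarr[OF \<sigma>(1)] by blast
  then obtain L where L: "cover q L" using cover_exists[OF qi oneideal] by blast
  have irr: "L \<subseteq> J" if J: "ideal J R" "q \<subset> J" for J
    using cover_between[OF L J(1) _ \<sigma>_above[OF J] \<sigma>_above[OF coverD(2,3)[OF L]] \<sigma>q] J(2) by blast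
  have "socle R \<mm> \<inter> (I \<inter> q) \<subseteq> T"
  proof
    fix y assume y: "y \<in> socle R \<mm> \<inter> (I \<inter> q)"
    show "y \<in> T"
    proof (rule ccontr)
      assume yT: "y \<notin> T"
      \<comment> \<open>An element of \<open>T' \<inter> q\<close> outside \<open>T\<close>
        generates \<open>T'\<close> over \<open>T\<close>, which would force \<open>\<sigma>\<close>
        into \<open>q\<close>.\<close>
      have "T' \<subseteq> q" using cover_between[OF TT' qi Tq _ _ yT] y I(2) by blast
      then show False using \<sigma>(1) \<sigma>q by blast
    qed
  qed
  moreover have "rank (?p i \<inter> I) + rank (?p (Suc i) \<inter> (I \<inter> q)) \<le>
    rank (?p (Suc i) \<inter> I) + rank (?p i \<inter> (I \<inter> q)) + w"
  proof -
    let ?X = "?p i \<inter> I" and ?Y = "?p (Suc i) \<inter> I"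
    have X: "ideal ?X R" and Y: "ideal ?Y R" using i_intersect[OF ideal_power_ideal I(1)] by blast+
    have sums: "ideal (?X <+> q) R" "ideal (?Y <+> q) R"
      using add_ideals[OF X qi] add_ideals[OF Y qi] .
    have YX: "?Y <+> q \<subseteq> ?X <+> q"
      using ideal_power_Suc_subset[of i] by (auto simp: set_add_def' simp del: nat_pow_Suc)
    have qY: "q \<subseteq> ?Y <+> q" by (rule subset_ideal_sum(2)[OF Y qi])
    have "rank (?X <+> q) \<le> rank (?Y <+> q) + w"
    proof (cases "i \<le> l")
      case True
      have "rank (?X <+> q) \<le> rank (?Y <+> q) + shifted_binomial (embedding_dim R \<mm>) (l - i)"
      proof (rule rank_le_shifted_binomial_dual[OF L irr sums qY YX])
        fix a x assume a: "a \<in> \<mm>" and "x \<in> ?X <+> q"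
        then obtain y t where yt: "y \<in> ?X" "t \<in> q" "x = y \<oplus> t" unfolding set_add_def' by blast
        have ac: "a \<in> carrier R" using m.Icarr[OF a] .
        have "a \<otimes> x = a \<otimes> y \<oplus> a \<otimes> t"
          unfolding yt(3) using ac ideal.Icarr[OF X yt(1)] q.Icarr[OF yt(2)] by (simp add: r_distr)
        moreover have "a \<otimes> y \<in> ?Y"
          using ideal_power_smult[OF a] ideal.I_l_closed[OF I(1) _ ac] yt(1) by blast
        moreover have "a \<otimes> t \<in> q" using yt(2) ac by (rule q.I_l_closed)
        ultimately show "a \<otimes> x \<in> ?Y <+> q" unfolding set_add_def' by blast
      next
        fix a x assume a: "a \<in> ?p (Suc (l - i))" and "x \<in> ?X <+> q"
        then obtain y t where yt: "y \<in> ?X" "t \<in> q" "x = y \<oplus> t" unfolding set_add_def' by blast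
        have ac: "a \<in> carrier R" using ideal.Icarr[OF ideal_power_ideal a] .
        have "a \<otimes> x = a \<otimes> y \<oplus> a \<otimes> t"
          unfolding yt(3) using ac ideal.Icarr[OF X yt(1)] q.Icarr[OF yt(2)] by (simp add: r_distr)
        moreover have "Suc (l - i) + i = Suc l" using True by simp
        then have "a \<otimes> y \<in> q" using ideal_power_mult[OF a, of y i] yt(1) pq by auto
        moreover have "a \<otimes> t \<in> q" using yt(2) ac by (rule q.I_l_closed)
        ultimately show "a \<otimes> x \<in> q" using q.a_closed by simp
      qed (use nz in auto)
      then show ?thesis using True by (simp add: w_def)
    next
      case False
      \<comment> \<open>For \<open>i > l\<close> already \<mm>^i lies in \<open>q\<close>, so
        nothing is lost in degree \<open>i\<close>; this is the value \<open>0\<close> of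
        \<open>w\<close>.\<close>
      then have "?X \<subseteq> q" using ideal_power_antimono[of "Suc l" i] pq by auto
      then have "?X <+> q \<subseteq> ?Y <+> q"
        using ideal_sum_subset[OF sums(2)] qY by blast
      then show ?thesis using rank_mono[OF sums] by simp
    qed
    \<comment> \<open>The modular law converts the comparison of \<open>?X <+> q\<close> with
      \<open>?Y <+> q\<close> into one of \<open>?X \<inter> q\<close> with
      \<open>?Y \<inter> q\<close>.\<close>
    moreover have "?p i \<inter> (I \<inter> q) = ?X \<inter> q" "?p (Suc i) \<inter> (I \<inter> q) = ?Y \<inter> q" by blast+
    ultimately show ?thesis using rank_modular[OF X qi] rank_modular[OF Y qi] by simp
  qed
  ultimately show ?thesis using i_intersect[OF I(1) qi] by blast
qed

lemma socle_composition_step: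
  fixes i l :: nat
  defines "w \<equiv> (if i \<le> l then shifted_binomial (embedding_dim R \<mm>) (l - i) else 0)"
  assumes TU: "composition T U n" and "U \<subseteq> socle R \<mm>"
    and Sl: "socle R \<mm> \<inter> ideal_power R \<mm> (Suc l) \<subseteq> T"
    and "ideal I R" "socle R \<mm> \<inter> I \<subseteq> U"
    and nz: "embedding_dim R \<mm> \<noteq> 0 \<or> l = 0"
  shows "\<exists>I'. ideal I' R \<and> socle R \<mm> \<inter> I' \<subseteq> T \<and>
    rank (ideal_power R \<mm> i \<inter> I) + rank (ideal_power R \<mm> (Suc i) \<inter> I') \<le>
    rank (ideal_power R \<mm> (Suc i) \<inter> I) + rank (ideal_power R \<mm> i \<inter> I') + n * w"
  using assms(2,3,5,6)
proof (induction arbitrary: I rule: composition.induct)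
  case refl
  then show ?case by (intro exI[of _ I]) simp
next
  case (step K n U)
  have TK: "T \<subseteq> K" by (rule composition_subset[OF step.hyps(1)])
  obtain I' where I': "ideal I' R" "socle R \<mm> \<inter> I' \<subseteq> K"
    "rank (ideal_power R \<mm> i \<inter> I) + rank (ideal_power R \<mm> (Suc i) \<inter> I') \<le>
    rank (ideal_power R \<mm> (Suc i) \<inter> I) + rank (ideal_power R \<mm> i \<inter> I') + w"
    using socle_cover_step[OF step.hyps(2) step.prems(1) subset_trans[OF Sl TK] step.prems(2,3) nz, of i]
    unfolding w_def by blast
  have KS: "K \<subseteq> socle R \<mm>" using coverD(3)[OF step.hyps(2)] step.prems(1) by blast
  obtain I'' where I'': "ideal I'' R" "socle R \<mm> \<inter> I'' \<subseteq> T"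
    "rank (ideal_power R \<mm> i \<inter> I') + rank (ideal_power R \<mm> (Suc i) \<inter> I'') \<le>
    rank (ideal_power R \<mm> (Suc i) \<inter> I') + rank (ideal_power R \<mm> i \<inter> I'') + n * w"
    using step.IH[OF KS I'(1,2)] by blast
  then show ?case using I'(3) by (intro exI[of _ I'']) (simp del: nat_pow_Suc)
qed

text \<open>With no generators \<mm> is zero. This supplies the condition \<open>nz\<close> of the
  descent when \<open>R\<close> is a field.\<close>

lemma embedding_dim_zero_imp: "embedding_dim R \<mm> = 0 \<Longrightarrow> top_socle_degree R \<mm> = 0"
proof (rule ccontr)
  assume e: "embedding_dim R \<mm> = 0" and s: "top_socle_degree R \<mm> \<noteq> 0"
  have "\<mm> \<subseteq> {\<zero>}" using maximal_ideal_generators zeroideal e by fastforce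
  then have "ideal_power R \<mm> (Suc 0) \<subseteq> {\<zero>}" unfolding ideal_power_one .
  then have "ideal_power R \<mm> (top_socle_degree R \<mm>) \<subseteq> {\<zero>}"
    using ideal_power_antimono[of "Suc 0" "top_socle_degree R \<mm>"] s by fastforce
  then show False
    using ideal_power_top_socle_degree zero_subset_ideal[OF ideal_power_ideal] by blast
qed

text \<open>The descent starts at \<open>I = R\<close> and runs down the socle filtration; its layer
  in degree \<open>n\<close> takes \<open>socle_coeff R \<mm> n\<close> steps. At the end
  \<open>I\<close> meets the socle only in zero, so \<open>I\<close> is zero by
  \<open>socle_essential\<close>, and the accumulated loss is at least the value of the Hilbert
  function at \<open>i\<close>.\<close>

lemma hilbert_fun_le_socle_sum:
  "hilbert_fun R \<mm> i \<le> (\<Sum>l=i..top_socle_degree R \<mm>.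
     socle_coeff R \<mm> l * shifted_binomial (embedding_dim R \<mm>) (l - i))"
proof -
  let ?p = "ideal_power R \<mm>" and ?S = "socle R \<mm>" and ?s = "top_socle_degree R \<mm>"
  let ?w = "\<lambda>l. if i \<le> l then shifted_binomial (embedding_dim R \<mm>) (l - i) else 0"
  \<comment> \<open>The invariant bounds the loss in the length of (\<mm>^i \<inter> I)/(\<mm>^(i+1)
    \<inter> I) so far; it is arranged as sums to avoid truncated subtraction.\<close>
  have "\<exists>I. ideal I R \<and> ?S \<inter> I \<subseteq> ?S \<inter> ?p n \<and>
    rank (?p i) + rank (?p (Suc i) \<inter> I) \<le>
    rank (?p (Suc i)) + rank (?p i \<inter> I) + (\<Sum>l<n. socle_coeff R \<mm> l * ?w l)"
    if "n \<le> Suc ?s" for n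
    using that
  proof (induction n)
    case 0
    have p: "?p j \<inter> carrier R = ?p j" for j using ideal.Icarr[OF ideal_power_ideal] by blast
    show ?case unfolding ideal_power_zero
      by (intro exI[of _ "carrier R"] conjI oneideal order_refl) (simp only: p)
  next
    case (Suc n)
    then obtain I where I: "ideal I R" "?S \<inter> I \<subseteq> ?S \<inter> ?p n"
      "rank (?p i) + rank (?p (Suc i) \<inter> I) \<le>
       rank (?p (Suc i)) + rank (?p i \<inter> I) + (\<Sum>l<n. socle_coeff R \<mm> l * ?w l)" by auto
    have "?S \<inter> ?p (Suc n) \<subseteq> ?S \<inter> ?p n" using ideal_power_Suc_subset by blast
    then obtain k where k: "composition (?S \<inter> ?p (Suc n)) (?S \<inter> ?p n) k"
      using composition_exists[OF socle_inter_ideal socle_inter_ideal] ideal_power_ideal by blast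
    have "k = socle_coeff R \<mm> n" using rank_composition[OF k] rank_socle_coeff[of n] by simp
    moreover have "embedding_dim R \<mm> \<noteq> 0 \<or> n = 0"
      using embedding_dim_zero_imp Suc.prems by (cases "embedding_dim R \<mm> = 0") auto
    ultimately obtain I' where I': "ideal I' R" "?S \<inter> I' \<subseteq> ?S \<inter> ?p (Suc n)"
      "rank (?p i \<inter> I) + rank (?p (Suc i) \<inter> I') \<le>
       rank (?p (Suc i) \<inter> I) + rank (?p i \<inter> I') + socle_coeff R \<mm> n * ?w n"
      using socle_composition_step[OF k Int_lower1 order_refl I(1,2), of i] by blast
    have "rank (?p i) + rank (?p (Suc i) \<inter> I') \<le>
      rank (?p (Suc i)) + rank (?p i \<inter> I') + (\<Sum>l<Suc n. socle_coeff R \<mm> l * ?w l)"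
      using I(3) I'(3) unfolding sum.lessThan_Suc by linarith
    then show ?case using I'(1,2) by blast
  qed
  from this[OF order_refl] obtain I where I: "ideal I R" "?S \<inter> I \<subseteq> ?S \<inter> ?p (Suc ?s)"
    "rank (?p i) + rank (?p (Suc i) \<inter> I) \<le>
     rank (?p (Suc i)) + rank (?p i \<inter> I) + (\<Sum>l<Suc ?s. socle_coeff R \<mm> l * ?w l)" by blast
  have "?p (Suc ?s) = {\<zero>}" by (rule ideal_power_above_top_socle_degree[OF lessI])
  then have "I = {\<zero>}" using socle_essential[OF I(1)] I(2) by blast
  then have "?p j \<inter> I = {\<zero>}" for j using zero_subset_ideal[OF ideal_power_ideal] by blast
  then have "hilbert_fun R \<mm> i \<le> (\<Sum>l<Suc ?s. socle_coeff R \<mm> l * ?w l)"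
    using I(3) rank_hilbert_fun[of i] by (simp del: nat_pow_Suc)
  also have "\<dots> = (\<Sum>l=i..?s. socle_coeff R \<mm> l * shifted_binomial (embedding_dim R \<mm>) (l - i))"
    by (rule sum.mono_neutral_cong_right) auto
  finally show ?thesis .
qed

text \<open>The nonzero ideal \<mm>^s meets the socle nontrivially by essentiality, while
  \<mm>^(s+1) is zero.\<close>

lemma socle_coeff_top: "1 \<le> socle_coeff R \<mm> (top_socle_degree R \<mm>)"
proof -
  let ?s = "top_socle_degree R \<mm>"
  have "ideal_power R \<mm> (Suc ?s) = {\<zero>}" by (rule ideal_power_above_top_socle_degree[OF lessI])
  then have "rank (socle R \<mm> \<inter> ideal_power R \<mm> (Suc ?s)) = 0"
    using zero_subset_ideal[OF socle_ideal] by (simp add: Int_absorb1 del: nat_pow_Suc)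
  moreover have "socle R \<mm> \<inter> ideal_power R \<mm> ?s \<noteq> {\<zero>}"
    using socle_essential[OF ideal_power_ideal] ideal_power_top_socle_degree by blast
  then have "{\<zero>} \<subset> socle R \<mm> \<inter> ideal_power R \<mm> ?s"
    using zero_subset_ideal[OF socle_inter_ideal[OF ideal_power_ideal]] by blast
  then have "0 < rank (socle R \<mm> \<inter> ideal_power R \<mm> ?s)"
    using rank_less[OF zeroideal socle_inter_ideal[OF ideal_power_ideal]] by fastforce
  ultimately show ?thesis using rank_socle_coeff[of ?s] by simp
qed

lemma hilbert_fun_zero_pos: "0 < hilbert_fun R \<mm> 0"
proof -
  have "rank \<mm> < rank (carrier R)"
    using m.I_notcarr m.a_subset by (intro rank_less m.is_ideal oneideal) auto
  then show ?thesis using rank_hilbert_fun[of 0] unfolding ideal_power_zero ideal_power_one by simp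
qed

end

section \<open>The length bound, its equality case and the bound on the top socle degree\<close>

theorem theorem4p4:
  fixes R :: "('a, 'b) ring_scheme" and \<mm> :: "'a set"
    and e s :: nat and c :: "nat \<Rightarrow> nat"
  assumes "local_artinian_ring R \<mm>"
    and "e = embedding_dim R \<mm>"
    and "s = top_socle_degree R \<mm>"
    and "socle_polynomial R \<mm> = (\<Sum>i=0..s. monom (c i) i)"
  shows "module_length R (regular_module R) \<le>
           enat (\<Sum>i=0..s. min (shifted_binomial e i)
                               (\<Sum>l=i..s. c l * shifted_binomial e (l - i)))
       \<and> (module_length R (regular_module R) =
           enat (\<Sum>i=0..s. min (shifted_binomial e i)
                               (\<Sum>l=i..s. c l * shifted_binomial e (l - i)))
          \<longleftrightarrow> compressed_local_artinian_ring R \<mm>)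
       \<and> (compressed_local_artinian_ring R \<mm> \<longrightarrow>
           enat s \<le> 2 * v_invariant R \<mm> - 1)"
proof -
  interpret local_artinian_ring R \<mm> by fact
  let ?b = "\<lambda>i. \<Sum>l=i..s. c l * shifted_binomial e (l - i)"
  let ?M = "\<lambda>i. min (shifted_binomial e i) (?b i)"
  let ?H = "hilbert_fun R \<mm>"
  have coeff_sum: "coeff (\<Sum>i=0..s. monom (f i) i) l = f l" if "l \<le> s" for f :: "nat \<Rightarrow> nat" and l
    using that by (simp add: coeff_sum)
  \<comment> \<open>The socle polynomial determines \<open>c l\<close> only for
    \<open>l \<le> s\<close>; no other values enter the sums.\<close>
  have c: "c l = socle_coeff R \<mm> l" if "l \<le> s" for l
    using assms(4) coeff_sum[OF that, of c] coeff_sum[OF that, of "socle_coeff R \<mm>"]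
    by (simp add: socle_polynomial_def assms(3))
  then have b: "?b i = (\<Sum>l=i..s. socle_coeff R \<mm> l * shifted_binomial e (l - i))" for i
    by (intro sum.cong) auto
  have le: "?H i \<le> ?M i" for i
    using hilbert_fun_le_shifted_binomial hilbert_fun_le_socle_sum b by (simp add: assms(2,3))
  have length: "module_length R (regular_module R) = enat (\<Sum>i=0..s. ?H i)"
    using module_length_regular_module rank_carrier_eq_sum_hilbert_fun by (simp add: assms(3))
  have compressed: "compressed_local_artinian_ring R \<mm> \<longleftrightarrow> (\<forall>i\<in>{0..s}. ?H i = ?M i)"
    using assms(1) b
    by (simp add: compressed_local_artinian_ring_def Let_def assms(2,3))
  have "(\<Sum>i=0..s. ?H i) = (\<Sum>i=0..s. ?M i) \<longleftrightarrow> (\<forall>i\<in>{0..s}. ?H i = ?M i)"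
    using sum_mono_inv[of ?H "{0..s}" ?M, OF _ le] by auto
  moreover have "enat s \<le> 2 * v_invariant R \<mm> - 1" if H: "\<forall>i\<in>{0..s}. ?H i = ?M i"
  proof (cases "{enat i | i. ?H i < shifted_binomial e i} = {}")
    case True
    \<comment> \<open>The infimum of the empty set is \<open>\<infinity>\<close>, and
      \<open>2 * \<infinity> - 1 = \<infinity>\<close>.\<close>
    then show ?thesis by (simp add: v_invariant_def assms(2) top_enat_def numeral_eq_enat one_enat_def)
  next
    case False
    then have "v_invariant R \<mm> \<in> {enat i | i. ?H i < shifted_binomial e i}"
      unfolding v_invariant_def assms(2) by (metis (no_types, lifting) Inf_enat_def LeastI ex_in_conv)
    then obtain v where v: "v_invariant R \<mm> = enat v" "?H v < shifted_binomial e v" by blast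
    have v0: "v \<noteq> 0" using v(2) hilbert_fun_zero_pos by (auto intro: Nat.gr0I)
    \<comment> \<open>For \<open>e = 0\<close> the binomial vanishes in the positive degree
      \<open>v\<close>, so the Hilbert function could not be below it. Monotonicity of the binomial
      in the degree uses \<open>e0\<close>.\<close>
    have e0: "e \<noteq> 0"
    proof
      assume "e = 0"
      then show False using v(2) v0 by (simp add: shifted_binomial_def binomial_eq_0)
    qed
    have "s < 2 * v"
    proof (cases "v \<le> s")
      case True
      \<comment> \<open>Only the term \<open>l = s\<close> of the sum is kept; its coefficient is at
        least one.\<close>
      have "shifted_binomial e (s - v) \<le> c s * shifted_binomial e (s - v)"
        using socle_coeff_top c[of s] by (simp add: assms(3))
      also have "\<dots> \<le> ?b v"
        using True by (intro member_le_sum) auto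
      \<comment> \<open>In degree \<open>v\<close> the Hilbert function is below the first entry of
        the minimum, so by \<open>H\<close> it equals the second.\<close>
      also have "\<dots> < shifted_binomial e v" using H v(2) True by (auto simp: min_def split: if_splits)
      finally have "\<not> v \<le> s - v" using shifted_binomial_mono[OF e0, of v "s - v"] by linarith
      then show ?thesis by linarith
    qed (use v0 in linarith)
    moreover have "2 * enat v - 1 = enat (2 * v - 1)"
      by (simp add: numeral_eq_enat one_enat_def)
    ultimately show ?thesis unfolding v(1) by simp
  qed
  ultimately show ?thesis unfolding length compressed using le by (auto intro: sum_mono)
qed

end
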